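(* Let $G=(V,E)$ be a finite graph with coupling constants $J:E\to[0,\infty)$. Let $g:V\to[-\infty,\infty]$ and $h:V\to[0,\infty]$ be such that $\min\{|g_v|,h_v\}<\infty$ for all $v\in V$. Then for any $o\in V$, $$\langle\sigma_o\rangle_{g+h}-\langle\sigma_o\rangle_{g-h}\le\langle\sigma_o\rangle_{h}-\langle\sigma_o\rangle_{-h}.$$
   Context: For a finite undirected graph $G=(V,E)$, write $u\sim v$ if $u,v\in V$ are connected by an edge. Given coupling constants $J:E\to[0,\infty)$ and an external field $f:V\to[-\infty,\infty]$, the Ising model on $G$ (the inverse temperature being absorbed into $J$, i.e. $\beta=1$) is the probability measure on $\{\pm1\}^V$ $$\mu_f(\sigma)=\frac1{Z_f}\exp\Big\{\sum_{u\sim v}J_{uv}\sigma_u\sigma_v+\sum_{u\in V}f_u\sigma_u\Big\},$$ where the first sum is over edges and $Z_f$ is the normalizing constant. If $f_u=+\infty$ (resp. $-\infty$) at some vertices $u$, this is understood as forcing $\sigma_u=+1$ (resp. $\sigma_u=-1$): $\mu_f$ is supported on configurations satisfying these constraints, with weight proportional to the exponential above where the field sum runs only over vertices with finite $f_u$. The expectation with respect to $\mu_f$ is denoted $\langle\cdot\rangle_f$. The fields $g\pm h$ are the pointwise sum and difference. *)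

theory Defs
  imports "HOL-Probability.Probability"
begin

text \<open>An undirected graph is given by a vertex set and a set of two-element edges; a coupling \<open>J\<close>
  is a function of the edge \<open>{u, v}\<close>, so that \<open>J\<^sub>u\<^sub>v = J\<^sub>v\<^sub>u\<close> by construction.\<close>

definition simple_graph :: "'a set \<Rightarrow> 'a set set \<Rightarrow> bool" where
  "simple_graph V E \<longleftrightarrow> (\<forall>e\<in>E. \<exists>u\<in>V. \<exists>v\<in>V. u \<noteq> v \<and> e = {u, v})"

definition spin_configs :: "'a set \<Rightarrow> ('a \<Rightarrow> ereal) \<Rightarrow> ('a \<Rightarrow> real) set" where
  "spin_configs V f = {\<sigma> \<in> V \<rightarrow>\<^sub>E {-1, 1}.
     \<forall>u\<in>V. (f u = \<infinity> \<longrightarrow> \<sigma> u = 1) \<and> (f u = -\<infinity> \<longrightarrow> \<sigma> u = -1)}"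

text \<open>The product over \<open>e = {u, v}\<close> is \<open>\<sigma>\<^sub>u \<sigma>\<^sub>v\<close>. The field sum runs only over vertices with
  finite field.\<close>

definition ising_weight ::
  "'a set \<Rightarrow> 'a set set \<Rightarrow> ('a set \<Rightarrow> real) \<Rightarrow> ('a \<Rightarrow> ereal) \<Rightarrow> ('a \<Rightarrow> real) \<Rightarrow> real" where
  "ising_weight V E J f \<sigma> = exp ((\<Sum>e\<in>E. J e * (\<Prod>u\<in>e. \<sigma> u)) +
     (\<Sum>u\<in>{u\<in>V. \<bar>f u\<bar> \<noteq> \<infinity>}. real_of_ereal (f u) * \<sigma> u))"

definition ising_Z ::
  "'a set \<Rightarrow> 'a set set \<Rightarrow> ('a set \<Rightarrow> real) \<Rightarrow> ('a \<Rightarrow> ereal) \<Rightarrow> real" where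
  "ising_Z V E J f = (\<Sum>\<sigma>\<in>spin_configs V f. ising_weight V E J f \<sigma>)"

text \<open>Meaningful for finite \<open>V\<close> only, see \<open>pmf_ising\<close> below.\<close>

definition ising ::
  "'a set \<Rightarrow> 'a set set \<Rightarrow> ('a set \<Rightarrow> real) \<Rightarrow> ('a \<Rightarrow> ereal) \<Rightarrow> ('a \<Rightarrow> real) pmf" where
  "ising V E J f = embed_pmf (\<lambda>\<sigma>. if \<sigma> \<in> spin_configs V f
     then ising_weight V E J f \<sigma> / ising_Z V E J f else 0)"

lemma finite_spin_configs: "finite V \<Longrightarrow> finite (spin_configs V f)"
  unfolding spin_configs_def by (rule finite_subset[of _ "V \<rightarrow>\<^sub>E {-1, 1}"]) (auto intro: finite_PiE)

lemma spin_configs_nonempty: "spin_configs V f \<noteq> {}"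
proof -
  have "(\<lambda>u\<in>V. if f u = -\<infinity> then -1 else 1) \<in> spin_configs V f"
    by (auto simp: spin_configs_def)
  then show ?thesis by blast
qed

lemma ising_Z_pos: "finite V \<Longrightarrow> ising_Z V E J f > 0"
  unfolding ising_Z_def
  by (rule sum_pos) (auto simp: finite_spin_configs spin_configs_nonempty ising_weight_def)

lemma pmf_ising:
  assumes "finite V"
  shows "pmf (ising V E J f) \<sigma> = (if \<sigma> \<in> spin_configs V f
    then ising_weight V E J f \<sigma> / ising_Z V E J f else 0)"
  unfolding ising_def
proof (rule pmf_embed_pmf)
  let ?S = "spin_configs V f"
  let ?p = "\<lambda>\<sigma>. if \<sigma> \<in> ?S then ising_weight V E J f \<sigma> / ising_Z V E J f else 0"
  have Z: "ising_Z V E J f > 0" by (rule ising_Z_pos[OF assms])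
  have nn: "0 \<le> ?p \<sigma>" for \<sigma> using Z by (simp add: ising_weight_def)
  then show "0 \<le> ?p \<sigma>" for \<sigma> .
  have "(\<integral>\<^sup>+\<sigma>. ennreal (?p \<sigma>) \<partial>count_space UNIV) = (\<Sum>\<sigma>\<in>?S. ennreal (?p \<sigma>))"
    by (rule nn_integral_count_space'[OF finite_spin_configs[OF assms]]) auto
  also have "\<dots> = ennreal (\<Sum>\<sigma>\<in>?S. ?p \<sigma>)"
    using nn by (intro sum_ennreal) blast
  also have "(\<Sum>\<sigma>\<in>?S. ?p \<sigma>) = (\<Sum>\<sigma>\<in>?S. ising_weight V E J f \<sigma> / ising_Z V E J f)"
    by (rule sum.cong) auto
  also have "\<dots> = 1"
    using Z by (simp add: sum_divide_distrib[symmetric] ising_Z_def)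
  finally show "(\<integral>\<^sup>+\<sigma>. ennreal (?p \<sigma>) \<partial>count_space UNIV) = 1" by simp
qed

definition ising_expectation ::
  "'a set \<Rightarrow> 'a set set \<Rightarrow> ('a set \<Rightarrow> real) \<Rightarrow> ('a \<Rightarrow> ereal) \<Rightarrow> (('a \<Rightarrow> real) \<Rightarrow> real) \<Rightarrow> real" where
  "ising_expectation V E J f X = measure_pmf.expectation (ising V E J f) X"

lemma ising_expectation_eq:
  assumes "finite V"
  shows "ising_expectation V E J f X =
    (\<Sum>\<sigma>\<in>spin_configs V f. X \<sigma> * ising_weight V E J f \<sigma>) / ising_Z V E J f"
proof -
  have "ising_expectation V E J f X =
      (\<Sum>\<sigma>\<in>spin_configs V f. X \<sigma> * pmf (ising V E J f) \<sigma>)"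
    unfolding ising_expectation_def
    by (rule integral_measure_pmf_real)
       (auto simp: finite_spin_configs assms set_pmf_iff pmf_ising split: if_splits)
  also have "\<dots> = (\<Sum>\<sigma>\<in>spin_configs V f. X \<sigma> * ising_weight V E J f \<sigma> / ising_Z V E J f)"
    by (rule sum.cong) (auto simp: pmf_ising assms)
  finally show ?thesis by (simp add: sum_divide_distrib)
qed

end

theory Submission
  imports Defs
begin

text \<open>Write \<open>Z\<^sub>V(f)\<close> for the partition function with finite field \<open>f\<close>. Summing out the spin at \<open>v\<^sub>0\<close>,
  whose couplings form a field \<open>k \<ge> 0\<close> on the other vertices, reduces the theorem to the statement
  that \<open>\<psi>\<^sub>V(a) = Z\<^sub>V(g + a) Z\<^sub>V(g - a) / Z\<^sub>V(a)\<^sup>2\<close> satisfies \<open>\<psi>\<^sub>V(h + k) \<le> \<psi>\<^sub>V(h - k)\<close> for all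
  \<open>h, k \<ge> 0\<close> and every \<open>g\<close>. For \<open>h = 0\<close> this is an equality, because \<open>\<psi>\<^sub>V\<close> is even. In general one
  raises the values \<open>h x\<close> from \<open>0\<close> one vertex at a time and looks at a point
  \<open>(h x, g x)\<close> where \<open>\<psi>\<^sub>V(h - k) / \<psi>\<^sub>V(h + k)\<close> is minimal. If the minimum were below \<open>1\<close>, the
  first-order conditions in \<open>h x\<close> and \<open>g x\<close> would contradict the inequality for \<open>V - {x}\<close> together
  with the supermodularity of \<open>ln Z\<close>. Infinite fields are limits of finite fields.\<close>

section \<open>The one-vertex inequality, by a minimum argument in two real variables\<close>

text \<open>The first-order conditions of \<open>pair_raise\<close> at a minimum, in normalised form: \<open>s, t\<close> are the logarithmic
  \<open>e\<close>-derivatives of the two numerators, \<open>P, q\<close> those of the denominators, and \<open>d\<close> is the common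
  logarithmic \<open>y\<close>-derivative of the numerators.\<close>

lemma contact_contradiction:
  fixes s t d P q :: real
  assumes s: "-1 < s" "s < 1" and t: "-1 < t" and P: "0 \<le> P" "P < 1" and q: "-1 < q" "q \<le> P"
    and self: "((1 + s)\<^sup>2 - d\<^sup>2) * (1 - P)\<^sup>2 \<le> ((1 - s)\<^sup>2 - d\<^sup>2) * (1 + P)\<^sup>2"
    and slope: "t - q \<le> s - P"
    and cross: "((1 + s)\<^sup>2 - d\<^sup>2) * (1 + q)\<^sup>2 < ((1 + t)\<^sup>2 - d\<^sup>2) * (1 + P)\<^sup>2"
  shows False
proof -
  \<comment> \<open>Both sides of \<open>self\<close> are differences of squares; four times this
    inequality is what remains. Since \<open>s * P < 1\<close>, it forces
    \<open>s \<le> P\<close>.\<close>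
  have "(1 - s * P) * (s - P) \<le> - (P * d\<^sup>2)"
    using self by (simp add: power2_eq_square algebra_simps)
  moreover have "0 \<le> P * d\<^sup>2" using P by simp
  ultimately have "(1 - s * P) * (s - P) \<le> 0" by linarith
  moreover have "s * P < 1"
  proof (cases "s \<le> 0")
    case True then show ?thesis using P mult_nonpos_nonneg[of s P] by linarith
  next
    case False then show ?thesis using s P mult_strict_mono[of s 1 P 1] by simp
  qed
  ultimately have sP: "s \<le> P" by (smt (verit) mult_pos_pos)
  \<comment> \<open>In ratios: \<open>(1 + t) / (1 + q) \<le> (1 + s) / (1 + P)\<close>. As
    \<open>s - P\<close> is not positive, replacing the factor \<open>1 + P\<close> by the smaller
    \<open>1 + q\<close> only increases the product. The \<open>d\<close> terms left after squaring
    have the right sign because \<open>q \<le> P\<close>.\<close>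
  have "(1 + t) * (1 + P) \<le> (1 + s) * (1 + q)"
  proof -
    have "(t - q) * (1 + P) \<le> (s - P) * (1 + P)"
      using slope P by (intro mult_right_mono) auto
    also have "\<dots> \<le> (s - P) * (1 + q)"
      using sP q by (intro mult_left_mono_neg) auto
    finally show ?thesis by (simp add: algebra_simps)
  qed
  then have "((1 + t) * (1 + P))\<^sup>2 \<le> ((1 + s) * (1 + q))\<^sup>2"
    using t P by (intro power_mono) auto
  moreover have "d\<^sup>2 * (1 + q)\<^sup>2 \<le> d\<^sup>2 * (1 + P)\<^sup>2"
    using q by (intro mult_left_mono power_mono) auto
  ultimately show False using cross unfolding power_mult_distrib left_diff_distrib
    by (simp add: mult.commute)
qed

text \<open>Summing out the spin at \<open>x\<close> turns \<open>Z(g + a) Z(g - a)\<close> and \<open>Z(a)\<^sup>2\<close> into the following functions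
  of \<open>e = exp (2 * h x)\<close> and \<open>y = exp (2 * g x)\<close>.\<close>

definition pair_num :: "real \<Rightarrow> real \<Rightarrow> real \<Rightarrow> real \<Rightarrow> real \<Rightarrow> real \<Rightarrow> real" where
  "pair_num A A' p p' e y = A * e + A' / e + p * y + p' / y"

definition pair_den :: "real \<Rightarrow> real \<Rightarrow> real \<Rightarrow> real" where
  "pair_den \<alpha> \<alpha>' e = (\<alpha> * e + \<alpha>')\<^sup>2 / e"

text \<open>For large \<open>y\<close> the term \<open>p * y\<close> dominates. This turns an
  inequality valid for all \<open>y\<close> into one between leading coefficients.\<close>

lemma nonneg_coeff_at_top:
  fixes c p q :: real
  assumes "\<And>y. 0 < y \<Longrightarrow> 0 \<le> c + p * y + q / y"
  shows "0 \<le> p"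
proof (rule ccontr)
  assume "\<not> 0 \<le> p"
  then have p: "p < 0" by simp
  \<comment> \<open>Chosen so that \<open>p * y\<close> outweighs \<open>c\<close> and
    \<open>q / y\<close> together; the summand 1 gives \<open>y \<ge> 1\<close>, hence
    \<open>q / y \<le> \<bar>q\<bar>\<close>.\<close>
  define y where "y = 1 + (\<bar>c\<bar> + \<bar>q\<bar> + 1) / (- p)"
  have y: "1 \<le> y" using p by (simp add: y_def divide_nonneg_neg)
  have "p * y = p - (\<bar>c\<bar> + \<bar>q\<bar> + 1)" using p by (simp add: y_def field_simps)
  moreover have "q / y \<le> \<bar>q\<bar>"
    using y by (smt (verit) abs_ge_zero divide_le_eq mult_le_cancel_left1 mult_less_0_iff abs_ge_self)
  ultimately have "c + p * y + q / y < 0" using p by linarith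
  then show False using assms[of y] y by linarith
qed

text \<open>The letters \<open>A\<close>, \<open>a\<close>, \<alpha> belong to the field
  \<open>h + k\<close>, and \<open>B\<close>, \<open>b\<close>, \<beta> to \<open>h - k\<close>. The
  hypothesis \<open>start\<close> is the case \<open>h x = 0\<close>, that is \<open>e = 1\<close>.
  If the claim failed, the ratio \<open>r\<close> would have a minimum below 1. The edge
  \<open>e = 1\<close> and the ends of the range of \<open>y\<close> are excluded, so the
  first-order conditions hold there and \<open>contact_contradiction\<close> applies.\<close>

lemma pair_raise:
  fixes A A' a a' \<alpha> \<alpha>' B B' b b' \<beta> \<beta>' :: real
  assumes pos: "0 < A" "0 < A'" "0 < a" "0 < a'" "0 < \<alpha>" "0 < \<alpha>'"
      "0 < B" "0 < B'" "0 < b" "0 < b'" "0 < \<beta>" "0 < \<beta>'"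
    and aa: "a * a' = A * A'" and bb: "b * b' = B * B'"
    and self: "A * \<alpha>'\<^sup>2 \<le> A' * \<alpha>\<^sup>2" and cross: "A * \<beta>\<^sup>2 \<le> B * \<alpha>\<^sup>2"
    and \<alpha>: "\<alpha>' \<le> \<alpha>" and \<alpha>\<beta>: "\<alpha>' * \<beta> \<le> \<alpha> * \<beta>'"
    and start: "\<And>y. 0 < y \<Longrightarrow>
      pair_num A A' a a' 1 y * pair_den \<beta> \<beta>' 1 \<le> pair_num B B' b b' 1 y * pair_den \<alpha> \<alpha>' 1"
    and E: "1 \<le> E" and Y: "0 < Y"
  shows "pair_num A A' a a' E Y * pair_den \<beta> \<beta>' E \<le> pair_num B B' b b' E Y * pair_den \<alpha> \<alpha>' E"
proof (rule ccontr)
  define NA where "NA = pair_num A A' a a'"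
  define NB where "NB = pair_num B B' b b'"
  define DA where "DA = pair_den \<alpha> \<alpha>'"
  define DB where "DB = pair_den \<beta> \<beta>'"
  \<comment> \<open>These are the numerators at \<open>y = u / (1 - u)\<close> multiplied by
    \<open>u * (1 - u)\<close>. The factor cancels in \<open>r\<close>, and in this form they are
    continuous up to \<open>u = 0\<close> and \<open>u = 1\<close>.\<close>
  define nA where "nA e u = (A * e + A' / e) * u * (1 - u) + a * u\<^sup>2 + a' * (1 - u)\<^sup>2" for e u
  define nB where "nB e u = (B * e + B' / e) * u * (1 - u) + b * u\<^sup>2 + b' * (1 - u)\<^sup>2" for e u
  define r where "r z = nB (fst z) (snd z) * DA (fst z) / (nA (fst z) (snd z) * DB (fst z))"
    for z :: "real \<times> real"
  assume "\<not> ?thesis"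
  then have viol: "NB E Y * DA E < NA E Y * DB E" by (simp add: NA_def NB_def DA_def DB_def)
  have DApos: "0 < DA e" and DBpos: "0 < DB e" if "0 < e" for e
    using that pos by (auto simp: DA_def DB_def pair_den_def intro!: divide_pos_pos zero_less_power add_pos_pos)
  have NApos: "0 < NA e y" and NBpos: "0 < NB e y" if "0 < e" "0 < y" for e y
    using that pos by (auto simp: NA_def NB_def pair_num_def intro!: add_pos_pos)
  have nApos: "0 < nA e u" if "0 < e" "0 \<le> u" "u \<le> 1" for e u
  proof -
    have "0 \<le> (A * e + A' / e) * u * (1 - u)" using that pos by (auto intro!: mult_nonneg_nonneg add_nonneg_nonneg)
    moreover have "0 < a * u\<^sup>2 + a' * (1 - u)\<^sup>2"
    proof (cases "u = 0")
      case False then show ?thesis using pos by (intro add_pos_nonneg) auto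
    qed (use pos in auto)
    ultimately show ?thesis by (simp add: nA_def)
  qed
  have nA_NA: "nA e u = u * (1 - u) * NA e (u / (1 - u))"
    and nB_NB: "nB e u = u * (1 - u) * NB e (u / (1 - u))" if "0 < u" "u < 1" for e u
    using that by (simp_all add: nA_def nB_def NA_def NB_def pair_num_def power2_eq_square distrib_left mult_ac)
  have r_NA: "r (e, u) = NB e (u / (1 - u)) * DA e / (NA e (u / (1 - u)) * DB e)" if "0 < u" "u < 1" for e u
    using that by (simp add: r_def nA_NA nB_NB)
  \<comment> \<open>\<open>u = y / (1 + y)\<close> compactifies the range of \<open>y\<close>.\<close>
  let ?K = "{1..E} \<times> {0..1::real}"
  have "continuous_on ?K r"
    unfolding r_def nA_def nB_def DA_def DB_def pair_den_def
  proof (intro continuous_intros ballI)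
    fix z assume z: "z \<in> ?K"
    have "0 < nA (fst z) (snd z)" "0 < DB (fst z)" using z nApos DBpos by auto
    then have "nA (fst z) (snd z) * DB (fst z) \<noteq> 0" by simp
    then show "((A * fst z + A' / fst z) * snd z * (1 - snd z) + a * (snd z)\<^sup>2 + a' * (1 - snd z)\<^sup>2) *
       ((\<beta> * fst z + \<beta>')\<^sup>2 / fst z) \<noteq> 0"
      unfolding nA_def DB_def pair_den_def .
  qed auto
  moreover have "compact ?K" "?K \<noteq> {}" using E by (auto intro: compact_Times)
  ultimately obtain z where z: "z \<in> ?K" and zmin: "\<And>w. w \<in> ?K \<Longrightarrow> r z \<le> r w"
    using continuous_attains_inf by metis
  obtain e u where zeu: "z = (e, u)" by (cases z)
  have e: "1 \<le> e" "e \<le> E" and u: "0 \<le> u" "u \<le> 1" using z zeu by auto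
  define m where "m = r z"
  have "r (E, Y / (1 + Y)) < 1"
  proof -
    have "1 - Y / (1 + Y) = 1 / (1 + Y)" using Y by (simp add: field_simps)
    then have "Y / (1 + Y) / (1 - Y / (1 + Y)) = Y" using Y by simp
    moreover have "0 < Y / (1 + Y)" "Y / (1 + Y) < 1" using Y by auto
    ultimately have "r (E, Y / (1 + Y)) = NB E Y * DA E / (NA E Y * DB E)" by (simp add: r_NA)
    also have "\<dots> < 1" using viol NApos[of E Y] DBpos[of E] E Y by (simp add: divide_less_eq)
    finally show ?thesis .
  qed
  then have m1: "m < 1" using zmin[of "(E, Y / (1 + Y))"] E Y by (simp add: m_def)
  \<comment> \<open>By \<alpha>\<beta>, the quotient \<open>DA / DB\<close> is at least its value at
    \<open>e = 1\<close>.\<close>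
  have den_mono: "DB x * DA 1 \<le> DA x * DB 1" if "1 \<le> x" for x
  proof -
    have "\<alpha>' * \<beta> * (x - 1) \<le> \<alpha> * \<beta>' * (x - 1)" using \<alpha>\<beta> that by (intro mult_right_mono) auto
    then have "(\<beta> * x + \<beta>') * (\<alpha> + \<alpha>') \<le> (\<alpha> * x + \<alpha>') * (\<beta> + \<beta>')" by (simp add: algebra_simps)
    then have "((\<beta> * x + \<beta>') * (\<alpha> + \<alpha>'))\<^sup>2 \<le> ((\<alpha> * x + \<alpha>') * (\<beta> + \<beta>'))\<^sup>2"
      using that pos by (intro power_mono) auto
    then show ?thesis using that
      by (simp add: DA_def DB_def pair_den_def power_mult_distrib divide_right_mono)
  qed
  \<comment> \<open>At \<open>u = 0\<close> and \<open>u = 1\<close> the numerators do not depend on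
    \<open>e\<close>, so the bound at \<open>e = 1\<close> persists for larger \<open>e\<close> by
    \<open>den_mono\<close>.\<close>
  have side: "1 \<le> nA' * DA x / (nB' * DB x)"
    if "nB' * DB 1 \<le> nA' * DA 1" "0 < nA'" "0 < nB'" "1 \<le> x" for nA' nB' x
  proof -
    have D: "0 < DA 1" "0 < DB 1" "0 < DA x" "0 < DB x" using DApos DBpos that by auto
    have "nB' * DB x * DA 1 \<le> nB' * (DA x * DB 1)"
      using den_mono[OF that(4)] that(3) by (simp add: mult.assoc)
    also have "\<dots> \<le> nA' * DA x * DA 1" using mult_right_mono[OF that(1), of "DA x"] D
      by (simp add: mult_ac)
    finally have "nB' * DB x \<le> nA' * DA x" using D by simp
    then show ?thesis using that D by (simp add: le_divide_eq)
  qed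
  have start': "0 \<le> (NB 1 y * DA 1 - NA 1 y * DB 1)" if "0 < y" for y
    using start[OF that] by (simp add: NA_def NB_def DA_def DB_def)
  have top: "a * DB 1 \<le> b * DA 1"
  proof -
    have "0 \<le> b * DA 1 - a * DB 1"
      by (rule nonneg_coeff_at_top[of "(B + B') * DA 1 - (A + A') * DB 1" _ "b' * DA 1 - a' * DB 1"])
         (use start' in \<open>simp add: NA_def NB_def pair_num_def algebra_simps diff_divide_distrib\<close>)
    then show ?thesis by simp
  qed
  have bot: "a' * DB 1 \<le> b' * DA 1"
  proof -
    have "0 \<le> b' * DA 1 - a' * DB 1"
    \<comment> \<open>The end \<open>y = 0\<close> is reduced to the other one by the substitution
      of \<open>1 / y\<close> for \<open>y\<close>.\<close>
    proof (rule nonneg_coeff_at_top[of "(B + B') * DA 1 - (A + A') * DB 1" _ "b * DA 1 - a * DB 1"])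
      fix y :: real assume "0 < y"
      then show "0 \<le> (B + B') * DA 1 - (A + A') * DB 1 + (b' * DA 1 - a' * DB 1) * y + (b * DA 1 - a * DB 1) / y"
        using start'[of "1 / y"] by (simp add: NA_def NB_def pair_num_def algebra_simps diff_divide_distrib)
    qed
    then show ?thesis by simp
  qed
  have "u \<noteq> 1"
  proof
    assume "u = 1"
    then have "m = b * DA e / (a * DB e)" by (simp add: m_def zeu r_def nA_def nB_def)
    then show False using side[OF top, of e] m1 pos e by simp
  qed
  moreover have "u \<noteq> 0"
  proof
    assume "u = 0"
    then have "m = b' * DA e / (a' * DB e)" by (simp add: m_def zeu r_def nA_def nB_def)
    then show False using side[OF bot, of e] m1 pos e by simp
  qed
  ultimately have u': "0 < u" "u < 1" using u by auto
  define y where "y = u / (1 - u)"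
  have y: "0 < y" using u' by (simp add: y_def)
  \<comment> \<open>Clearing the denominators of \<open>r \<ge> m\<close> gives a function that is
    nonnegative and vanishes at the minimum, so no quotient has to be differentiated.\<close>
  define F where "F x v = NB x v * DA x - m * (NA x v * DB x)" for x v
  have Fnn: "0 \<le> F x v" if "1 \<le> x" "x \<le> E" "0 < v" for x v
  proof -
    have v: "v / (1 + v) / (1 - v / (1 + v)) = v" "0 < v / (1 + v)" "v / (1 + v) < 1"
      using that by (auto simp: field_simps)
    have "m \<le> r (x, v / (1 + v))" using zmin that v by (auto simp: m_def)
    also have "\<dots> = NB x v * DA x / (NA x v * DB x)" using v by (simp add: r_NA)
    finally show ?thesis using NApos[of x v] DBpos[of x] that by (simp add: F_def le_divide_eq)
  qed
  have m_eq: "m = NB e y * DA e / (NA e y * DB e)" by (simp add: m_def zeu r_NA u' y_def)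
  have e0: "0 < e" using e by simp
  have Npos: "0 < NA e y" "0 < NB e y" "0 < DA e" "0 < DB e"
    using NApos NBpos DApos DBpos e0 y by auto
  have F0: "F e y = 0" using Npos by (simp add: F_def m_eq)
  have "e \<noteq> 1"
  proof
    assume "e = 1"
    then have "1 \<le> m" using start'[OF y] Npos by (simp add: m_eq)
    then show False using m1 by simp
  qed
  then have e1: "1 < e" using e by simp
  have dy: "(b - b' / y\<^sup>2) * DA e - m * ((a - a' / y\<^sup>2) * DB e) = 0"
  proof (rule DERIV_local_min[of "F e" _ y y])
    show "(F e has_real_derivative (b - b' / y\<^sup>2) * DA e - m * ((a - a' / y\<^sup>2) * DB e)) (at y)"
      unfolding F_def NA_def NB_def pair_num_def using y
      by (auto intro!: derivative_eq_intros simp: power2_eq_square)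
    show "\<forall>v. \<bar>y - v\<bar> < y \<longrightarrow> F e y \<le> F e v" using F0 Fnn e by auto
  qed (rule y)
  define dDA where "dDA = (\<alpha>\<^sup>2 - \<alpha>'\<^sup>2 / e\<^sup>2)"
  define dDB where "dDB = (\<beta>\<^sup>2 - \<beta>'\<^sup>2 / e\<^sup>2)"
  let ?l = "(B - B' / e\<^sup>2) * DA e + NB e y * dDA - m * ((A - A' / e\<^sup>2) * DB e + NA e y * dDB)"
  have "((\<lambda>x. F x y) has_real_derivative ?l) (at e)"
  proof -
    have num: "((\<lambda>x. pair_num C C' p p' x y) has_real_derivative C - C' / e\<^sup>2) (at e)" for C C' p p'
      unfolding pair_num_def using e0 by (auto intro!: derivative_eq_intros simp: power2_eq_square)
    have den: "(pair_den \<gamma> \<gamma>' has_real_derivative \<gamma>\<^sup>2 - \<gamma>'\<^sup>2 / e\<^sup>2) (at e)" for \<gamma> \<gamma>'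
    proof -
      have "(2 * (\<gamma> * (\<gamma> * e + \<gamma>')) * e - (\<gamma> * e + \<gamma>')\<^sup>2) / (e * e) = \<gamma>\<^sup>2 - \<gamma>'\<^sup>2 / e\<^sup>2"
        using e0 by (simp add: field_simps power2_eq_square)
      then show ?thesis
        unfolding pair_den_def using e0 by (auto intro!: derivative_eq_intros)
    qed
    show ?thesis unfolding F_def
      by (rule derivative_eq_intros refl num[of A A' a a', folded NA_def] num[of B B' b b', folded NB_def] 
          den[of \<alpha> \<alpha>', folded DA_def dDA_def] den[of \<beta> \<beta>', folded DB_def dDB_def])+
        simp
  qed
  \<comment> \<open>The minimum may lie on the edge \<open>e = E\<close>, so only smaller values of
    \<open>e\<close> are compared; \<open>1 < e\<close> leaves room for them.\<close>
  then have "?l \<le> 0"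
  proof (rule contrapos_pp)
    assume "\<not> ?l \<le> 0"
    then have "0 < ?l" by simp
    show "\<not> ((\<lambda>x. F x y) has_real_derivative ?l) (at e)"
    proof
      assume "((\<lambda>x. F x y) has_real_derivative ?l) (at e)"
      from DERIV_pos_inc_left[OF this \<open>0 < ?l\<close>] obtain d where d: "0 < d"
        "\<And>h. 0 < h \<Longrightarrow> h < d \<Longrightarrow> F (e - h) y < F e y" by auto
      define h where "h = min (d / 2) (e - 1)"
      have "0 < h" "h < d" "1 \<le> e - h" "e - h \<le> E" using d e1 e by (auto simp: h_def)
      then show False using d(2)[of h] Fnn[of "e - h" y] F0 y by force
    qed
  qed
  note slope = this
  define N M where "N = NA e y" and "M = NB e y"
  define s where "s = (A * e - A' / e) / N"
  define t where "t = (B * e - B' / e) / M"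
  define d where "d = (a * y - a' / y) / N"
  define P where "P = (\<alpha> * e - \<alpha>') / (\<alpha> * e + \<alpha>')"
  define q where "q = (\<beta> * e - \<beta>') / (\<beta> * e + \<beta>')"
  have NM: "0 < N" "0 < M" using Npos by (auto simp: N_def M_def)
  have N_eq: "N = A * e + A' / e + (a * y + a' / y)" and M_eq: "M = B * e + B' / e + (b * y + b' / y)"
    by (simp_all add: N_def M_def NA_def NB_def pair_num_def)
  have m_eq': "m = M * DA e / (N * DB e)" by (simp add: m_eq N_def M_def)
  \<comment> \<open>The denominators do not involve \<open>y\<close>, so stationarity in
    \<open>y\<close> says that both numerators have the same logarithmic derivative.\<close>
  have d_eq: "d = (b * y - b' / y) / M"
  proof -
    have "(b * y - b' / y) * DA e - m * ((a * y - a' / y) * DB e) = y * 0"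
      unfolding dy[symmetric] using y by (simp add: field_simps power2_eq_square)
    moreover have "m * ((a * y - a' / y) * DB e) = M / N * (a * y - a' / y) * DA e"
      using Npos by (simp add: m_eq')
    ultimately have "(b * y - b' / y) * DA e = M / N * (a * y - a' / y) * DA e" by simp
    then have "b * y - b' / y = M / N * (a * y - a' / y)"
      by (rule mult_right_cancel[THEN iffD1, rotated]) (use Npos in auto)
    then show ?thesis using NM by (simp add: d_def)
  qed
  have pose: "0 < A * e" "0 < A' / e" "0 < B * e" "0 < B' / e" "0 < a * y" "0 < a' / y"
      "0 < b * y" "0 < b' / y" "0 < \<alpha> * e" "0 < \<beta> * e"
    using pos e0 y by auto
  \<comment> \<open>The relations \<open>aa\<close> and \<open>bb\<close> make these differences of
    squares collapse to a single coefficient.\<close>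
  have sq: "(1 + s)\<^sup>2 - d\<^sup>2 = 4 * (A * e) / N" "(1 - s)\<^sup>2 - d\<^sup>2 = 4 * (A' / e) / N"
      "(1 + t)\<^sup>2 - d\<^sup>2 = 4 * (B * e) / M"
  proof -
    have *: "(1 + (X - X') / K)\<^sup>2 - ((Z - Z') / K)\<^sup>2 = 4 * X / K"
      if K: "K = X + X' + (Z + Z')" "0 < K" and XZ: "Z * Z' = X * X'" for X X' Z Z' K :: real
    proof -
      have "(K + (X - X'))\<^sup>2 - (Z - Z')\<^sup>2 = 4 * X * K"
        unfolding K(1) using XZ by (simp add: power2_eq_square algebra_simps)
      moreover have "(1 + (X - X') / K)\<^sup>2 - ((Z - Z') / K)\<^sup>2 = ((K + (X - X'))\<^sup>2 - (Z - Z')\<^sup>2) / K\<^sup>2"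
        using K(2) by (simp add: field_simps power2_eq_square)
      ultimately show ?thesis using K(2) by (simp add: power2_eq_square)
    qed
    show "(1 + s)\<^sup>2 - d\<^sup>2 = 4 * (A * e) / N"
      unfolding s_def d_def by (rule *) (use N_eq NM aa e0 y in auto)
    show "(1 + t)\<^sup>2 - d\<^sup>2 = 4 * (B * e) / M"
      unfolding t_def d_eq by (rule *) (use M_eq NM bb e0 y in auto)
    have "(1 + (A' / e - A * e) / N)\<^sup>2 - ((a * y - a' / y) / N)\<^sup>2 = 4 * (A' / e) / N"
      by (rule *) (use N_eq NM aa e0 y in auto)
    moreover have "1 + (A' / e - A * e) / N = 1 - s" by (simp add: s_def diff_divide_distrib)
    ultimately show "(1 - s)\<^sup>2 - d\<^sup>2 = 4 * (A' / e) / N" by (simp add: d_def)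
  qed
  have den: "0 < \<alpha> * e + \<alpha>'" "0 < \<beta> * e + \<beta>'" using pos pose by auto
  have P1: "1 + P = 2 * (\<alpha> * e) / (\<alpha> * e + \<alpha>')" "1 - P = 2 * \<alpha>' / (\<alpha> * e + \<alpha>')"
    and q1: "1 + q = 2 * (\<beta> * e) / (\<beta> * e + \<beta>')"
    using den by (simp_all add: P_def q_def field_simps)
  have logDA: "dDA = DA e * P / e" and logDB: "dDB = DB e * q / e"
  proof -
    have "\<gamma>\<^sup>2 - \<gamma>'\<^sup>2 / e\<^sup>2 = pair_den \<gamma> \<gamma>' e * ((\<gamma> * e - \<gamma>') / (\<gamma> * e + \<gamma>')) / e"
      if "0 < \<gamma> * e + \<gamma>'" for \<gamma> \<gamma>'
    proof -
      have "pair_den \<gamma> \<gamma>' e * ((\<gamma> * e - \<gamma>') / (\<gamma> * e + \<gamma>')) / e = (\<gamma> * e + \<gamma>') * (\<gamma> * e - \<gamma>') / e\<^sup>2"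
        using that by (simp add: pair_den_def power2_eq_square)
      then show ?thesis using e0 by (simp add: field_simps power2_eq_square)
    qed
    then show "dDA = DA e * P / e" "dDB = DB e * q / e"
      using den by (simp_all add: dDA_def dDB_def DA_def DB_def P_def q_def)
  qed
  show False
  proof (rule contact_contradiction[of s t P q d])
    show "-1 < s" "s < 1" "-1 < t"
    proof -
      have "- N < A * e - A' / e" "A * e - A' / e < N" "- M < B * e - B' / e"
        unfolding N_eq M_eq using pose by linarith+
      then show "-1 < s" "s < 1" "-1 < t"
        using NM by (simp_all add: s_def t_def less_divide_eq divide_less_eq)
    qed
    have "\<alpha>' \<le> \<alpha> * e" using \<alpha> mult_left_mono[of 1 e \<alpha>] e pos(5) by linarith
    then show "0 \<le> P" "P < 1" using den pos by (auto simp: P_def)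
    show "-1 < q" using den pos pose by (simp add: q_def field_simps)
    have "\<alpha>' * \<beta> * e \<le> \<alpha> * \<beta>' * e" using \<alpha>\<beta> e0 by simp
    then have "(\<beta> * e - \<beta>') * (\<alpha> * e + \<alpha>') \<le> (\<alpha> * e - \<alpha>') * (\<beta> * e + \<beta>')"
      by (simp add: algebra_simps)
    then show "q \<le> P" unfolding P_def q_def using den by (simp only: pos_divide_le_eq pos_le_divide_eq times_divide_eq_left)
    show "((1 + s)\<^sup>2 - d\<^sup>2) * (1 - P)\<^sup>2 \<le> ((1 - s)\<^sup>2 - d\<^sup>2) * (1 + P)\<^sup>2"
    proof -
      have "A * e * \<alpha>'\<^sup>2 \<le> A' / e * (\<alpha> * e)\<^sup>2"
        using mult_right_mono[OF self, of e] e0 by (simp add: field_simps power2_eq_square)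
      then have "16 * (A * e * \<alpha>'\<^sup>2) / (N * (\<alpha> * e + \<alpha>')\<^sup>2)
          \<le> 16 * (A' / e * (\<alpha> * e)\<^sup>2) / (N * (\<alpha> * e + \<alpha>')\<^sup>2)"
        using NM by (intro divide_right_mono) auto
      then show ?thesis by (simp add: sq P1 power_divide power_mult_distrib mult_ac)
    qed
    show "((1 + s)\<^sup>2 - d\<^sup>2) * (1 + q)\<^sup>2 < ((1 + t)\<^sup>2 - d\<^sup>2) * (1 + P)\<^sup>2"
    proof -
      \<comment> \<open>Here \<open>m < 1\<close> makes the inequality derived from
        \<open>cross\<close> strict.\<close>
      have "M * DA e < N * DB e" using m1 NM Npos by (simp add: m_eq' divide_less_eq)
      then have "B * \<alpha>\<^sup>2 * (M * DA e) < B * \<alpha>\<^sup>2 * (N * DB e)"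
        using pos by simp
      then have "A * \<beta>\<^sup>2 * (M * DA e) < B * \<alpha>\<^sup>2 * (N * DB e)"
        using mult_right_mono[OF cross, of "M * DA e"] NM Npos by (smt (verit) mult_pos_pos)
      then have "A * \<beta>\<^sup>2 / (N * DB e) < B * \<alpha>\<^sup>2 / (M * DA e)"
        using NM Npos by (simp add: field_simps)
      then have "16 * e ^ 2 * (A * \<beta>\<^sup>2 / (N * DB e)) < 16 * e ^ 2 * (B * \<alpha>\<^sup>2 / (M * DA e))"
        using e0 by (intro mult_strict_left_mono) auto
      then show ?thesis unfolding sq P1 q1 DA_def DB_def pair_den_def using NM den e0
        by (simp add: power_divide power_mult_distrib power2_eq_square mult_ac)
    qed
    show "t - q \<le> s - P"
    proof -
      have "e * ((B - B' / e\<^sup>2) * DA e + M * dDA - m * ((A - A' / e\<^sup>2) * DB e + N * dDB)) \<le> e * 0"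
        using slope e0 by (intro mult_left_mono) (auto simp: N_def M_def)
      moreover have "e * ((B - B' / e\<^sup>2) * DA e + M * dDA - m * ((A - A' / e\<^sup>2) * DB e + N * dDB))
          = M * DA e * ((t - q) - (s - P))"
      proof -
        have 1: "e * (B - B' / e\<^sup>2) = M * t" "e * (A - A' / e\<^sup>2) = N * s"
          using e0 NM by (simp_all add: t_def s_def field_simps power2_eq_square)
        have 2: "e * dDA = DA e * P" "e * dDB = DB e * q"
          using e0 by (simp_all add: logDA logDB)
        have 3: "m * (N * DB e) = M * DA e" using Npos NM by (simp add: m_eq')
        have "e * ((B - B' / e\<^sup>2) * DA e + M * dDA - m * ((A - A' / e\<^sup>2) * DB e + N * dDB))
          = (e * (B - B' / e\<^sup>2)) * DA e + M * (e * dDA)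
            - m * ((e * (A - A' / e\<^sup>2)) * DB e + N * (e * dDB))"
          by (simp add: algebra_simps)
        also have "\<dots> = M * DA e * (t + P) - (m * (N * DB e)) * (s + q)"
          unfolding 1 2 by (simp add: algebra_simps)
        finally show ?thesis unfolding 3 by (simp add: algebra_simps)
      qed
      ultimately have "M * DA e * ((t - q) - (s - P)) \<le> 0" by simp
      then have "(t - q) - (s - P) \<le> 0" using NM Npos by (simp add: mult_le_0_iff)
      then show ?thesis by simp
    qed
  qed
qed

section \<open>From a product inequality to a bound on a difference of magnetizations\<close>

text \<open>The pairs are the weights of the two spin values at one vertex under
  \<open>g + h\<close>, \<open>g - h\<close> and \<open>h\<close>. With
  \<open>a = sqrt (p * s)\<close> and \<open>b = sqrt (q * r)\<close>, the left side has numerator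
  \<open>2 * (a\<^sup>2 - b\<^sup>2)\<close> and, by the arithmetic-geometric mean inequality,
  denominator at least \<open>(a + b)\<^sup>2\<close>. If \<open>a > b\<close> it is therefore at
  most \<open>2 * (a - b) / (a + b)\<close>, and \<open>le\<close> says
  \<open>a * Q \<le> b * P\<close>.\<close>

lemma magnetization_gap_le:
  fixes p q r s P Q :: real
  assumes pos: "0 < p" "0 < q" "0 < r" "0 < s" "0 < P" "0 < Q" and PQ: "Q \<le> P"
    and le: "p * s * Q\<^sup>2 \<le> q * r * P\<^sup>2"
  shows "(p - q) / (p + q) - (r - s) / (r + s) \<le> 2 * ((P - Q) / (P + Q))"
proof -
  define a b where "a = sqrt (p * s)" and "b = sqrt (q * r)"
  have ab: "0 < a" "0 < b" "a\<^sup>2 = p * s" "b\<^sup>2 = q * r" using pos by (auto simp: a_def b_def)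
  have eq: "(p - q) / (p + q) - (r - s) / (r + s) = 2 * ((a\<^sup>2 - b\<^sup>2) / ((p + q) * (r + s)))"
    using pos by (simp add: ab field_simps)
  have "(a + b)\<^sup>2 \<le> (p + q) * (r + s)"
  proof -
    have "(a * b)\<^sup>2 = (p * r) * (q * s)" by (simp add: power_mult_distrib ab mult_ac)
    then have "a * b = sqrt ((p * r) * (q * s))" using ab by (metis less_imp_le mult_nonneg_nonneg real_sqrt_abs abs_of_nonneg)
    also have "\<dots> \<le> (p * r + q * s) / 2" using pos by (intro arith_geo_mean_sqrt) auto
    finally show ?thesis by (simp add: power2_sum ab algebra_simps)
  qed
  show ?thesis
  proof (cases "a \<le> b")
    case True
    then have "a\<^sup>2 \<le> b\<^sup>2" using ab by (intro power_mono) auto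
    then have "2 * ((a\<^sup>2 - b\<^sup>2) / ((p + q) * (r + s))) \<le> 0"
      using pos by (simp add: divide_le_0_iff)
    also have "0 \<le> 2 * ((P - Q) / (P + Q))" using pos PQ by simp
    finally show ?thesis unfolding eq .
  next
    case False
    have "(a * Q)\<^sup>2 \<le> (b * P)\<^sup>2" using le by (simp add: power_mult_distrib ab)
    then have aQ: "a * Q \<le> b * P" using ab pos by (simp add: power2_le_iff_abs_le abs_of_pos)
    have "(a\<^sup>2 - b\<^sup>2) / ((p + q) * (r + s)) \<le> (a\<^sup>2 - b\<^sup>2) / (a + b)\<^sup>2"
    proof (rule divide_left_mono)
      show "0 \<le> a\<^sup>2 - b\<^sup>2" using ab False power_mono[of b a 2] by simp
    qed (use \<open>(a + b)\<^sup>2 \<le> _\<close> ab pos in auto)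
    also have "\<dots> = (a - b) / (a + b)"
      using ab(1,2) by (simp add: power2_eq_square square_diff_square_factored)
    also have "\<dots> \<le> (P - Q) / (P + Q)"
    proof -
      have "(a - b) * (P + Q) \<le> (P - Q) * (a + b)" using aQ by (simp add: algebra_simps)
      then show ?thesis using ab pos by (simp only: pos_divide_le_eq pos_le_divide_eq times_divide_eq_left add_pos_pos)
    qed
    finally show ?thesis unfolding eq by (intro mult_left_mono) simp_all
  qed
qed

section \<open>Partition functions with finite fields, and summing out one spin\<close>

lemma sum_PiE_insert:
  assumes "x \<notin> V"
  shows "(\<Sum>\<sigma>\<in>insert x V \<rightarrow>\<^sub>E S. F \<sigma>) = (\<Sum>s\<in>S. \<Sum>\<sigma>\<in>V \<rightarrow>\<^sub>E S. F (\<sigma>(x := s)))"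
proof -
  have "(\<Sum>\<sigma>\<in>insert x V \<rightarrow>\<^sub>E S. F \<sigma>) = sum (F \<circ> (\<lambda>(s, \<sigma>). \<sigma>(x := s))) (S \<times> (V \<rightarrow>\<^sub>E S))"
    unfolding PiE_insert_eq by (rule sum.reindex) (rule inj_combinator[OF assms])
  then show ?thesis by (simp add: sum.cartesian_product case_prod_unfold o_def)
qed

text \<open>Expand \<open>(a - c) * (a - d) \<ge> 0\<close>. It handles the opposite-spin terms in
  \<open>Z_supermodular\<close>, which cannot be compared one by one.\<close>

lemma sum_le_sum_of_prod_le:
  fixes a b c d :: real
  assumes "0 < a" "c \<le> a" "d \<le> a" "c * d \<le> a * b"
  shows "c + d \<le> a + b"
proof -
  have "0 \<le> (a - c) * (a - d)" using assms by simp
  then have "a * (c + d) \<le> a * (a + b)" using assms(4) by (simp add: algebra_simps)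
  then show ?thesis using assms(1) by simp
qed

text \<open>Equal spins in the two factors come first, opposite spins last. For the fields
  \<open>g + a\<close> and \<open>g - a\<close>, the exponentials of the former involve only
  \<open>g x\<close> and those of the latter only \<open>a x\<close>.\<close>

lemma exp_product:
  fixes a b A A' B B' :: real
  shows "(exp a * A + exp (- a) * A') * (exp b * B + exp (- b) * B')
    = exp (a + b) * (A * B) + exp (- (a + b)) * (A' * B') + (exp (a - b) * (A * B') + exp (b - a) * (A' * B))"
proof -
  have "exp (a + b) = exp a * exp b" "exp (- (a + b)) = exp (- a) * exp (- b)"
    "exp (a - b) = exp a * exp (- b)" "exp (b - a) = exp (- a) * exp b"
    by (simp_all flip: exp_add)
  then show ?thesis by (simp only: distrib_left distrib_right mult_ac add_ac)
qed

text \<open>Only edges inside \<open>V\<close> count, so that \<open>E\<close> and \<open>J\<close>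
  stay fixed while vertices are removed in inductions.\<close>

definition boltzmann :: "'a set set \<Rightarrow> ('a set \<Rightarrow> real) \<Rightarrow> 'a set \<Rightarrow> ('a \<Rightarrow> real) \<Rightarrow> ('a \<Rightarrow> real) \<Rightarrow> real" where
  "boltzmann E J V f \<sigma> = exp ((\<Sum>e | e \<in> E \<and> e \<subseteq> V. J e * (\<Prod>u\<in>e. \<sigma> u)) + (\<Sum>u\<in>V. f u * \<sigma> u))"

locale ferromagnet =
  fixes E :: "'a set set" and J :: "'a set \<Rightarrow> real"
  assumes edges: "e \<in> E \<Longrightarrow> \<exists>u v. u \<noteq> v \<and> e = {u, v}"
    and J_nonneg: "e \<in> E \<Longrightarrow> 0 \<le> J e"
begin

definition Z :: "'a set \<Rightarrow> ('a \<Rightarrow> real) \<Rightarrow> real" where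
  "Z V f = (\<Sum>\<sigma>\<in>V \<rightarrow>\<^sub>E {-1, 1}. boltzmann E J V f \<sigma>)"

text \<open>Fixing the spin at \<open>x\<close> adds this function, times that spin, to the field on
  the other vertices.\<close>

definition nbr :: "'a \<Rightarrow> 'a \<Rightarrow> real" where
  "nbr x y = (if {x, y} \<in> E then J {x, y} else 0)"

lemma nbr_nonneg: "0 \<le> nbr x y"
  by (simp add: nbr_def J_nonneg)

lemma Z_cong: "(\<And>x. x \<in> V \<Longrightarrow> f x = f' x) \<Longrightarrow> Z V f = Z V f'"
  by (simp add: Z_def boltzmann_def)

lemma interaction_insert:
  assumes "finite V" "x \<notin> V"
  shows "(\<Sum>e | e \<in> E \<and> e \<subseteq> insert x V. J e * (\<Prod>u\<in>e. (\<sigma>(x := s)) u))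
    = (\<Sum>e | e \<in> E \<and> e \<subseteq> V. J e * (\<Prod>u\<in>e. \<sigma> u)) + s * (\<Sum>y\<in>V. nbr x y * \<sigma> y)" (is "?L = ?R + _")
proof -
  let ?N = "{y \<in> V. {x, y} \<in> E}"
  have split: "{e. e \<in> E \<and> e \<subseteq> insert x V} = {e. e \<in> E \<and> e \<subseteq> V} \<union> (\<lambda>y. {x, y}) ` ?N"
  proof (intro equalityI subsetI)
    fix e assume e: "e \<in> {e. e \<in> E \<and> e \<subseteq> insert x V}"
    then obtain u v where uv: "u \<noteq> v" "e = {u, v}" using edges[of e] by auto
    show "e \<in> {e. e \<in> E \<and> e \<subseteq> V} \<union> (\<lambda>y. {x, y}) ` ?N"
    proof (cases "x \<in> e")
      case True
      then obtain y where "e = {x, y}" "y \<noteq> x" using uv by auto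
      then show ?thesis using e by auto
    qed (use e in auto)
  qed auto
  have fin: "finite {e. e \<in> E \<and> e \<subseteq> V}"
    by (rule finite_subset[of _ "Pow V"]) (use assms in auto)
  have inj: "inj_on (\<lambda>y. {x, y}) ?N" by (auto simp: inj_on_def doubleton_eq_iff)
  have "?L = (\<Sum>e | e \<in> E \<and> e \<subseteq> V. J e * (\<Prod>u\<in>e. (\<sigma>(x := s)) u))
      + (\<Sum>e\<in>(\<lambda>y. {x, y}) ` ?N. J e * (\<Prod>u\<in>e. (\<sigma>(x := s)) u))"
    unfolding split by (rule sum.union_disjoint) (use fin assms in auto)
  also have "(\<Sum>e | e \<in> E \<and> e \<subseteq> V. J e * (\<Prod>u\<in>e. (\<sigma>(x := s)) u)) = ?R"
    using assms by (intro sum.cong prod.cong arg_cong2[of _ _ _ _ "(*)"]) auto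
  also have "(\<Sum>e\<in>(\<lambda>y. {x, y}) ` ?N. J e * (\<Prod>u\<in>e. (\<sigma>(x := s)) u)) = (\<Sum>y\<in>?N. s * (nbr x y * \<sigma> y))"
    unfolding sum.reindex[OF inj]
  proof (rule sum.cong)
    fix y assume y: "y \<in> ?N"
    then have "y \<noteq> x" using assms by auto
    then show "((\<lambda>e. J e * (\<Prod>u\<in>e. (\<sigma>(x := s)) u)) \<circ> (\<lambda>y. {x, y})) y = s * (nbr x y * \<sigma> y)"
      using y by (simp add: nbr_def)
  qed simp
  also have "\<dots> = (\<Sum>y\<in>V. s * (nbr x y * \<sigma> y))"
    by (rule sum.mono_neutral_left) (use assms in \<open>auto simp: nbr_def\<close>)
  finally show ?thesis by (simp add: sum_distrib_left)
qed

text \<open>The factor \<phi> covers two uses: the constant 1 gives the partition function, the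
  identity the numerator of the magnetization at \<open>x\<close>.\<close>

lemma weighted_sum_insert:
  assumes "finite V" "x \<notin> V"
  shows "(\<Sum>\<sigma>\<in>insert x V \<rightarrow>\<^sub>E {-1, 1}. \<phi> (\<sigma> x) * boltzmann E J (insert x V) f \<sigma>)
    = (\<Sum>s\<in>{-1, 1}. \<phi> s * (exp (s * f x) * Z V (\<lambda>y. f y + s * nbr x y)))"
  unfolding sum_PiE_insert[OF assms(2)]
proof (rule sum.cong)
  fix s :: real
  have "boltzmann E J (insert x V) f (\<sigma>(x := s))
      = exp (s * f x) * boltzmann E J V (\<lambda>y. f y + s * nbr x y) \<sigma>" for \<sigma> :: "'a \<Rightarrow> real"
  proof -
    have "(\<Sum>u\<in>V. f u * (\<sigma>(x := s)) u) = (\<Sum>u\<in>V. f u * \<sigma> u)"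
      using assms by (intro sum.cong) auto
    then have field: "(\<Sum>u\<in>insert x V. f u * (\<sigma>(x := s)) u) = f x * s + (\<Sum>u\<in>V. f u * \<sigma> u)"
      using assms by simp
    have "I + s * (\<Sum>y\<in>V. nbr x y * \<sigma> y) + (f x * s + (\<Sum>u\<in>V. f u * \<sigma> u))
        = s * f x + (I + (\<Sum>u\<in>V. (f u + s * nbr x u) * \<sigma> u))" for I
      by (simp add: sum.distrib sum_distrib_left distrib_right mult.assoc)
    then show ?thesis
      unfolding boltzmann_def interaction_insert[OF assms] field by (simp only: exp_add)
  qed
  then show "(\<Sum>\<sigma>\<in>V \<rightarrow>\<^sub>E {-1, 1}. \<phi> ((\<sigma>(x := s)) x) * boltzmann E J (insert x V) f (\<sigma>(x := s)))
      = \<phi> s * (exp (s * f x) * Z V (\<lambda>y. f y + s * nbr x y))"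
    by (simp add: Z_def sum_distrib_left)
qed simp

lemma Z_insert:
  assumes "finite V" "x \<notin> V"
  shows "Z (insert x V) f = exp (f x) * Z V (\<lambda>y. f y + nbr x y) + exp (- f x) * Z V (\<lambda>y. f y - nbr x y)"
  using weighted_sum_insert[OF assms, of "\<lambda>_. 1" f] by (simp add: Z_def)

lemma Z_pos: "finite V \<Longrightarrow> 0 < Z V f"
proof (induction V arbitrary: f rule: finite_induct)
  case empty show ?case by (simp add: Z_def boltzmann_def)
qed (simp add: Z_insert add_pos_pos)

lemma Z_uminus: "finite V \<Longrightarrow> Z V (\<lambda>x. - f x) = Z V f"
proof (induction V arbitrary: f rule: finite_induct)
  case empty show ?case by (simp add: Z_def boltzmann_def)
next
  case (insert x V)
  show ?case using insert.IH[of "\<lambda>y. f y + nbr x y"] insert.IH[of "\<lambda>y. f y - nbr x y"]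
    by (simp add: Z_insert insert.hyps)
qed

section \<open>Supermodularity of ln Z in the field\<close>

text \<open>Induction on \<open>V\<close>: the product of two partition functions is expanded over
  the pair of spins at the new vertex. Equal spins are compared term by term, opposite spins through
  \<open>sum_le_sum_of_prod_le\<close>.\<close>

lemma Z_supermodular:
  assumes "finite V" and "\<And>x. x \<in> V \<Longrightarrow> 0 \<le> p x" and "\<And>x. x \<in> V \<Longrightarrow> 0 \<le> q x"
  shows "Z V (\<lambda>x. f x + p x) * Z V (\<lambda>x. f x + q x) \<le> Z V (\<lambda>x. f x + p x + q x) * Z V f"
  using assms
proof (induction V arbitrary: f p q rule: finite_induct)
  case empty show ?case by (simp add: Z_def boltzmann_def)
next
  case (insert x V)
  let ?j = "nbr x"
  have p: "\<And>y. y \<in> V \<Longrightarrow> 0 \<le> p y" and q: "\<And>y. y \<in> V \<Longrightarrow> 0 \<le> q y"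
    and px: "0 \<le> p x" and qx: "0 \<le> q x"
    using insert.prems by auto
  define z where "z s g = Z V (\<lambda>y. g y + s * ?j y)" for s g
  have zpos: "0 < z s g" for s g using insert.hyps by (simp add: z_def Z_pos)
  have rec: "Z (insert x V) g = exp (g x) * z 1 g + exp (- g x) * z (-1) g" for g
    using insert.hyps by (simp add: Z_insert z_def)
  let ?p = "\<lambda>y. f y + p y" and ?q = "\<lambda>y. f y + q y" and ?pq = "\<lambda>y. f y + p y + q y"
  have same: "z s ?p * z s ?q \<le> z s ?pq * z s f" for s
    using insert.IH[of p q "\<lambda>y. f y + s * ?j y"] p q by (simp add: z_def add_ac)
  \<comment> \<open>Starting from the field with spin -1 at \<open>x\<close>, a change of that spin
    to 1 is the nonnegative increment \<open>2 * ?j y\<close>, which is absorbed into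
    \<open>p\<close> or \<open>q\<close>.\<close>
  have mixed1: "z 1 ?p * z (-1) ?q \<le> z 1 ?pq * z (-1) f"
    using insert.IH[of "\<lambda>y. p y + 2 * ?j y" q "\<lambda>y. f y - ?j y"] p q nbr_nonneg
    by (simp add: z_def algebra_simps)
  have mixed2: "z (-1) ?p * z 1 ?q \<le> z 1 ?pq * z (-1) f"
    using insert.IH[of p "\<lambda>y. q y + 2 * ?j y" "\<lambda>y. f y - ?j y"] p q nbr_nonneg
    by (simp add: z_def algebra_simps)
  let ?a = "exp (p x + q x) * (z 1 ?pq * z (-1) f)" and ?b = "exp (- (p x + q x)) * (z (-1) ?pq * z 1 f)"
  let ?c = "exp (p x - q x) * (z 1 ?p * z (-1) ?q)" and ?d = "exp (q x - p x) * (z (-1) ?p * z 1 ?q)"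
  have "?c + ?d \<le> ?a + ?b"
  proof (rule sum_le_sum_of_prod_le)
    show "0 < ?a" using zpos by simp
    show "?c \<le> ?a" using mixed1 px qx zpos by (rule_tac mult_mono) (auto intro: less_imp_le)
    show "?d \<le> ?a" using mixed2 px qx zpos by (rule_tac mult_mono) (auto intro: less_imp_le)
    have "(z 1 ?p * z 1 ?q) * (z (-1) ?p * z (-1) ?q) \<le> (z 1 ?pq * z 1 f) * (z (-1) ?pq * z (-1) f)"
      using same zpos by (rule_tac mult_mono) (auto intro: less_imp_le)
    moreover have "(u * X) * (v * Y) = X * Y" if "u * v = 1" for u v X Y :: real
    proof -
      have "(u * X) * (v * Y) = (u * v) * (X * Y)" by (simp only: mult_ac)
      then show ?thesis using that by simp
    qed
    then have "?c * ?d = (z 1 ?p * z (-1) ?q) * (z (-1) ?p * z 1 ?q)"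
      "?a * ?b = (z 1 ?pq * z (-1) f) * (z (-1) ?pq * z 1 f)"
      by (simp_all flip: exp_add)
    ultimately show "?c * ?d \<le> ?a * ?b" by (simp only: mult_ac)
  qed
  moreover have "exp (2 * f x + p x + q x) * (z 1 ?p * z 1 ?q) \<le> exp (2 * f x + p x + q x) * (z 1 ?pq * z 1 f)"
    "exp (- (2 * f x + p x + q x)) * (z (-1) ?p * z (-1) ?q) \<le> exp (- (2 * f x + p x + q x)) * (z (-1) ?pq * z (-1) f)"
    using same by simp_all
  moreover have "Z (insert x V) ?p * Z (insert x V) ?q = exp (2 * f x + p x + q x) * (z 1 ?p * z 1 ?q)
      + exp (- (2 * f x + p x + q x)) * (z (-1) ?p * z (-1) ?q) + (?c + ?d)"
    unfolding rec exp_product by (simp add: algebra_simps)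
  moreover have "Z (insert x V) ?pq * Z (insert x V) f = exp (2 * f x + p x + q x) * (z 1 ?pq * z 1 f)
      + exp (- (2 * f x + p x + q x)) * (z (-1) ?pq * z (-1) f) + (?a + ?b)"
    unfolding rec exp_product by (simp add: algebra_simps)
  ultimately show ?case by linarith
qed


text \<open>Supermodularity at the base field \<open>- j\<close> with increments \<open>a\<close>
  and \<open>2 * j\<close>; the remaining factors \<open>Z V j\<close> and \<open>Z V (- j)\<close>
  are equal by spin flip and cancel.\<close>

lemma Z_field_diff_le_add:
  assumes "finite V" and "\<And>x. x \<in> V \<Longrightarrow> 0 \<le> a x" and "\<And>x. x \<in> V \<Longrightarrow> 0 \<le> j x"
  shows "Z V (\<lambda>x. a x - j x) \<le> Z V (\<lambda>x. a x + j x)"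
proof -
  have "Z V (\<lambda>x. - j x + a x) * Z V (\<lambda>x. - j x + 2 * j x)
      \<le> Z V (\<lambda>x. - j x + a x + 2 * j x) * Z V (\<lambda>x. - j x)"
    using assms by (intro Z_supermodular) auto
  then show ?thesis using Z_uminus[OF assms(1), of j] Z_pos[OF assms(1), of j]
    by (simp add: add.commute)
qed

section \<open>Comparison of the fields \<open>h + k\<close> and \<open>h - k\<close>, by induction
  on vertices\<close>

text \<open>This is \<open>\<psi>(h + k) \<le> \<psi>(h - k)\<close> with the denominators cleared.\<close>

definition zero_field_dominates :: "'a set \<Rightarrow> ('a \<Rightarrow> real) \<Rightarrow> ('a \<Rightarrow> real) \<Rightarrow> ('a \<Rightarrow> real) \<Rightarrow> bool" where
  "zero_field_dominates V g h k \<longleftrightarrow>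
    Z V (\<lambda>x. g x + (h x + k x)) * Z V (\<lambda>x. g x - (h x + k x)) * (Z V (\<lambda>x. h x - k x))\<^sup>2
    \<le> Z V (\<lambda>x. g x + (h x - k x)) * Z V (\<lambda>x. g x - (h x - k x)) * (Z V (\<lambda>x. h x + k x))\<^sup>2"

text \<open>Summing out \<open>x\<close> gives the setting of \<open>pair_raise\<close> with
  \<open>e = exp (2 * h x)\<close> and \<open>y = exp (2 * g x)\<close>. Its hypotheses on the
  coefficients come from \<open>IH\<close> and supermodularity on \<open>V\<close>;
  \<open>start\<close> must hold for every value of \<open>g\<close> at \<open>x\<close>.\<close>

lemma zero_field_dominates_insert:
  assumes V: "finite V" "x \<notin> V"
    and IH: "\<And>g h k. (\<And>y. y \<in> V \<Longrightarrow> 0 \<le> h y) \<Longrightarrow> (\<And>y. y \<in> V \<Longrightarrow> 0 \<le> k y) \<Longrightarrow> zero_field_dominates V g h k"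
    and h: "\<And>y. y \<in> insert x V \<Longrightarrow> 0 \<le> h y" and k: "\<And>y. y \<in> insert x V \<Longrightarrow> 0 \<le> k y"
    and start: "\<And>\<gamma>. zero_field_dominates (insert x V) (g(x := \<gamma>)) (h(x := 0)) k"
  shows "zero_field_dominates (insert x V) g h k"
proof -
  let ?j = "nbr x"
  \<comment> \<open>\<open>w c d m n\<close> has field \<open>c g + d h + m k + n j\<close>, where \<open>j\<close> are the couplings at \<open>x\<close>.\<close>
  define w where "w c d m n = Z V (\<lambda>y. c * g y + (d * h y + m * k y) + n * ?j y)" for c d m n :: real
  have wpos: "0 < w c d m n" for c d m n using V by (simp add: w_def Z_pos)
  define ek where "ek = exp (k x)"
  have ek: "1 \<le> ek" using k by (simp add: ek_def)
  \<comment> \<open>Used with \<open>s = 1\<close> and \<open>s = -1\<close>, for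
    \<open>h + k\<close> and \<open>h - k\<close>. The factor \<open>exp (s * k x)\<close> goes into
    the coefficients, leaving \<eta> and \<gamma> as the variables.\<close>
  have num: "Z (insert x V) (\<lambda>y. (g(x := \<gamma>)) y + ((h(x := \<eta>)) y + s * k y))
      * Z (insert x V) (\<lambda>y. (g(x := \<gamma>)) y - ((h(x := \<eta>)) y + s * k y))
      = pair_num (c\<^sup>2 * (w 1 1 s 1 * w 1 (-1) (-s) (-1))) (w 1 1 s (-1) * w 1 (-1) (-s) 1 / c\<^sup>2)
          (w 1 1 s 1 * w 1 (-1) (-s) 1) (w 1 1 s (-1) * w 1 (-1) (-s) (-1)) (exp (2 * \<eta>)) (exp (2 * \<gamma>))"
    if c: "c = exp (s * k x)" for \<gamma> \<eta> s c
  proof -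
    have "Z (insert x V) (\<lambda>y. (g(x := \<gamma>)) y + ((h(x := \<eta>)) y + s * k y))
        = exp (\<gamma> + (\<eta> + s * k x)) * w 1 1 s 1 + exp (- (\<gamma> + (\<eta> + s * k x))) * w 1 1 s (-1)"
      unfolding Z_insert[OF V] w_def
      by (rule arg_cong2[of _ _ _ _ "(+)"]; rule arg_cong2[of _ _ _ _ "(*)"]; (rule Z_cong)?; use V in auto)
    moreover have "Z (insert x V) (\<lambda>y. (g(x := \<gamma>)) y - ((h(x := \<eta>)) y + s * k y))
        = exp (\<gamma> - (\<eta> + s * k x)) * w 1 (-1) (-s) 1 + exp (- (\<gamma> - (\<eta> + s * k x))) * w 1 (-1) (-s) (-1)"
      unfolding Z_insert[OF V] w_def
      by (rule arg_cong2[of _ _ _ _ "(+)"]; rule arg_cong2[of _ _ _ _ "(*)"]; (rule Z_cong)?; use V in auto)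
    moreover have "exp (\<gamma> + (\<eta> + s * k x) + (\<gamma> - (\<eta> + s * k x))) = exp (2 * \<gamma>)"
      "exp (- (\<gamma> + (\<eta> + s * k x) + (\<gamma> - (\<eta> + s * k x)))) = 1 / exp (2 * \<gamma>)"
      by (simp_all add: exp_minus inverse_eq_divide)
    moreover have "exp (\<gamma> + (\<eta> + s * k x) - (\<gamma> - (\<eta> + s * k x))) = c\<^sup>2 * exp (2 * \<eta>)"
      "exp (\<gamma> - (\<eta> + s * k x) - (\<gamma> + (\<eta> + s * k x))) = 1 / c\<^sup>2 / exp (2 * \<eta>)"
    proof -
      have "c\<^sup>2 = exp (2 * (s * k x))" by (simp only: c exp_double)
      moreover have "1 / c\<^sup>2 = exp (- (2 * (s * k x)))"
        unfolding calculation by (simp add: exp_minus inverse_eq_divide)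
      ultimately show "exp (\<gamma> + (\<eta> + s * k x) - (\<gamma> - (\<eta> + s * k x))) = c\<^sup>2 * exp (2 * \<eta>)"
        "exp (\<gamma> - (\<eta> + s * k x) - (\<gamma> + (\<eta> + s * k x))) = 1 / c\<^sup>2 / exp (2 * \<eta>)"
        by (simp_all only: flip: exp_add exp_diff) (simp_all add: algebra_simps)
    qed
    ultimately show ?thesis
      by (simp only: exp_product pair_num_def) (simp add: mult_ac)
  qed
  have den: "(Z (insert x V) (\<lambda>y. (h(x := \<eta>)) y + s * k y))\<^sup>2
      = pair_den (c * w 0 1 s 1) (w 0 1 s (-1) / c) (exp (2 * \<eta>))" if c: "c = exp (s * k x)" for \<eta> s c
  proof -
    have "Z (insert x V) (\<lambda>y. (h(x := \<eta>)) y + s * k y)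
        = exp (\<eta> + s * k x) * w 0 1 s 1 + exp (- (\<eta> + s * k x)) * w 0 1 s (-1)"
      unfolding Z_insert[OF V] w_def
      by (rule arg_cong2[of _ _ _ _ "(+)"]; rule arg_cong2[of _ _ _ _ "(*)"]; (rule Z_cong)?; use V in auto)
    also have "\<dots> = exp (- \<eta>) * (exp (s * k x) * w 0 1 s 1 * exp (2 * \<eta>) + exp (- (s * k x)) * w 0 1 s (-1))"
    proof -
      have "exp (\<eta> + s * k x) = exp (- \<eta>) * exp (s * k x) * exp (2 * \<eta>)"
        "exp (- (\<eta> + s * k x)) = exp (- \<eta>) * exp (- (s * k x))"
        by (simp_all flip: exp_add)
      then show ?thesis by (simp only: distrib_left mult_ac)
    qed
    finally have "(Z (insert x V) (\<lambda>y. (h(x := \<eta>)) y + s * k y))\<^sup>2 = (exp (- \<eta>))\<^sup>2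
        * (exp (s * k x) * w 0 1 s 1 * exp (2 * \<eta>) + exp (- (s * k x)) * w 0 1 s (-1))\<^sup>2"
      by (simp only: power_mult_distrib)
    moreover have "(exp (- \<eta>))\<^sup>2 = 1 / exp (2 * \<eta>)"
      by (simp add: exp_minus exp_double power_inverse inverse_eq_divide power_divide)
    ultimately show ?thesis unfolding c by (simp add: pair_den_def exp_minus inverse_eq_divide)
  qed
  have dom: "zero_field_dominates (insert x V) (g(x := \<gamma>)) (h(x := \<eta>)) k \<longleftrightarrow>
      pair_num (ek\<^sup>2 * (w 1 1 1 1 * w 1 (-1) (-1) (-1))) (w 1 1 1 (-1) * w 1 (-1) (-1) 1 / ek\<^sup>2)
          (w 1 1 1 1 * w 1 (-1) (-1) 1) (w 1 1 1 (-1) * w 1 (-1) (-1) (-1)) (exp (2 * \<eta>)) (exp (2 * \<gamma>))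
        * pair_den (1 / ek * w 0 1 (-1) 1) (w 0 1 (-1) (-1) / (1 / ek)) (exp (2 * \<eta>))
      \<le> pair_num ((1 / ek)\<^sup>2 * (w 1 1 (-1) 1 * w 1 (-1) 1 (-1))) (w 1 1 (-1) (-1) * w 1 (-1) 1 1 / (1 / ek)\<^sup>2)
          (w 1 1 (-1) 1 * w 1 (-1) 1 1) (w 1 1 (-1) (-1) * w 1 (-1) 1 (-1)) (exp (2 * \<eta>)) (exp (2 * \<gamma>))
        * pair_den (ek * w 0 1 1 1) (w 0 1 1 (-1) / ek) (exp (2 * \<eta>))" for \<gamma> \<eta>
  proof -
    have "ek = exp (1 * k x)" "1 / ek = exp (-1 * k x)" by (simp_all add: ek_def exp_minus inverse_eq_divide)
    note num[OF this(1), of \<gamma> \<eta>] num[OF this(2), of \<gamma> \<eta>] den[OF this(1), of \<eta>] den[OF this(2), of \<eta>]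
    then show ?thesis
      unfolding zero_field_dominates_def by (simp only: mult_1 mult_minus1 minus_minus add_uminus_conv_diff)
  qed
  have hV: "0 \<le> h y" and kV: "0 \<le> k y" if "y \<in> V" for y using h k that by auto
  have "zero_field_dominates (insert x V) (g(x := g x)) (h(x := h x)) k"
    unfolding dom
  proof (rule pair_raise)
    \<comment> \<open>For \<open>self\<close>, the couplings at \<open>x\<close> play the part of
      \<open>k\<close>, and \<open>h + k\<close> that of \<open>h\<close>.\<close>
    have "zero_field_dominates V g (\<lambda>y. h y + k y) ?j"
      using hV kV nbr_nonneg by (intro IH) auto
    then have "w 1 1 1 1 * w 1 (-1) (-1) (-1) * (w 0 1 1 (-1))\<^sup>2
        \<le> w 1 1 1 (-1) * w 1 (-1) (-1) 1 * (w 0 1 1 1)\<^sup>2"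
      by (simp add: zero_field_dominates_def w_def algebra_simps)
    then show "ek\<^sup>2 * (w 1 1 1 1 * w 1 (-1) (-1) (-1)) * (w 0 1 1 (-1) / ek)\<^sup>2
        \<le> w 1 1 1 (-1) * w 1 (-1) (-1) 1 / ek\<^sup>2 * (ek * w 0 1 1 1)\<^sup>2"
      using ek by (simp add: power_divide power_mult_distrib)
    \<comment> \<open>For \<open>cross\<close>, the couplings at \<open>x\<close> are added to
      \<open>h\<close> instead.\<close>
    have "zero_field_dominates V g (\<lambda>y. h y + ?j y) k"
      using hV kV nbr_nonneg by (intro IH) auto
    then have "w 1 1 1 1 * w 1 (-1) (-1) (-1) * (w 0 1 (-1) 1)\<^sup>2
        \<le> w 1 1 (-1) 1 * w 1 (-1) 1 (-1) * (w 0 1 1 1)\<^sup>2"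
      by (simp add: zero_field_dominates_def w_def algebra_simps)
    then show "ek\<^sup>2 * (w 1 1 1 1 * w 1 (-1) (-1) (-1)) * (1 / ek * w 0 1 (-1) 1)\<^sup>2
        \<le> (1 / ek)\<^sup>2 * (w 1 1 (-1) 1 * w 1 (-1) 1 (-1)) * (ek * w 0 1 1 1)\<^sup>2"
      using ek by (simp add: power_divide power_mult_distrib)
    have "w 0 1 1 (-1) \<le> w 0 1 1 1"
      using Z_field_diff_le_add[of V "\<lambda>y. h y + k y" ?j] V hV kV nbr_nonneg by (simp add: w_def)
    moreover have "w 0 1 1 (-1) / ek \<le> w 0 1 1 (-1) / 1"
      using ek wpos by (intro divide_left_mono) (auto intro: less_imp_le)
    moreover have "1 * w 0 1 1 1 \<le> ek * w 0 1 1 1"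
      using ek wpos by (intro mult_right_mono) (auto intro: less_imp_le)
    ultimately show "w 0 1 1 (-1) / ek \<le> ek * w 0 1 1 1" by linarith
    \<comment> \<open>Supermodularity with increments \<open>2 * k\<close> and \<open>2 * ?j\<close>
      gives \<alpha>\<beta>; the powers of \<open>ek\<close> only help.\<close>
    have "w 0 1 1 (-1) * w 0 1 (-1) 1 \<le> w 0 1 1 1 * w 0 1 (-1) (-1)"
      using Z_supermodular[of V "\<lambda>y. 2 * k y" "\<lambda>y. 2 * ?j y" "\<lambda>y. h y - k y - ?j y"] V kV nbr_nonneg
      by (simp add: w_def algebra_simps)
    also have "\<dots> \<le> ek ^ 4 * (w 0 1 1 1 * w 0 1 (-1) (-1))"
      using one_le_power[OF ek, of 4] wpos by (simp add: less_imp_le)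
    finally show "w 0 1 1 (-1) / ek * (1 / ek * w 0 1 (-1) 1) \<le> ek * w 0 1 1 1 * (w 0 1 (-1) (-1) / (1 / ek))"
      using ek by (simp add: field_simps power4_eq_xxxx)
    show "pair_num (ek\<^sup>2 * (w 1 1 1 1 * w 1 (-1) (-1) (-1))) (w 1 1 1 (-1) * w 1 (-1) (-1) 1 / ek\<^sup>2)
          (w 1 1 1 1 * w 1 (-1) (-1) 1) (w 1 1 1 (-1) * w 1 (-1) (-1) (-1)) 1 y
        * pair_den (1 / ek * w 0 1 (-1) 1) (w 0 1 (-1) (-1) / (1 / ek)) 1
      \<le> pair_num ((1 / ek)\<^sup>2 * (w 1 1 (-1) 1 * w 1 (-1) 1 (-1))) (w 1 1 (-1) (-1) * w 1 (-1) 1 1 / (1 / ek)\<^sup>2)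
          (w 1 1 (-1) 1 * w 1 (-1) 1 1) (w 1 1 (-1) (-1) * w 1 (-1) 1 (-1)) 1 y
        * pair_den (ek * w 0 1 1 1) (w 0 1 1 (-1) / ek) 1" if "0 < y" for y
      using start[of "ln y / 2"] that unfolding dom by simp
    show "1 \<le> exp (2 * h x)" using h by simp
  qed (use ek wpos in \<open>simp_all add: mult_ac\<close>)
  then show ?thesis by simp
qed

text \<open>Two nested inductions: the outer one on the number of vertices supplies the inequality
  on \<open>V - {x}\<close>, the inner one on the number of vertices with
  \<open>h x \<noteq> 0\<close> supplies the case \<open>h x = 0\<close>.\<close>

lemma zero_field_dominates:
  assumes "finite V" and "\<And>x. x \<in> V \<Longrightarrow> 0 \<le> h x" and "\<And>x. x \<in> V \<Longrightarrow> 0 \<le> k x"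
  shows "zero_field_dominates V g h k"
  using assms
proof (induction "card V" arbitrary: V g h k rule: less_induct)
  case less
  note IH = less.hyps and V = less.prems(1) and k = less.prems(3)
  from less.prems(2) show ?case
  proof (induction "card {x \<in> V. h x \<noteq> 0}" arbitrary: g h rule: less_induct)
    case (less h g)
    show ?case
    proof (cases "\<exists>x\<in>V. h x \<noteq> 0")
      case False
      \<comment> \<open>With \<open>h = 0\<close> the two numerator factors merely change places,
        and the denominators agree by spin flip.\<close>
      have "Z V (\<lambda>x. h x + k x) = Z V k" "Z V (\<lambda>x. h x - k x) = Z V (\<lambda>x. - k x)"
        "Z V (\<lambda>x. g x + (h x + k x)) = Z V (\<lambda>x. g x + k x)" "Z V (\<lambda>x. g x - (h x + k x)) = Z V (\<lambda>x. g x - k x)"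
        "Z V (\<lambda>x. g x + (h x - k x)) = Z V (\<lambda>x. g x - k x)" "Z V (\<lambda>x. g x - (h x - k x)) = Z V (\<lambda>x. g x + k x)"
        by (rule Z_cong; use False in auto)+
      then show ?thesis using V by (simp add: zero_field_dominates_def Z_uminus)
    next
      case True
      then obtain x where x: "x \<in> V" "h x \<noteq> 0" by blast
      let ?W = "V - {x}"
      have W: "insert x ?W = V" "finite ?W" "x \<notin> ?W" using x V by auto
      have cardW: "card ?W < card V" by (rule psubset_card_mono) (use x V in auto)
      have sub: "{y \<in> V. (h(x := 0)) y \<noteq> 0} \<subset> {y \<in> V. h y \<noteq> 0}" using x by auto
      have "zero_field_dominates (insert x ?W) g h k"
      proof (rule zero_field_dominates_insert[OF W(2,3)])
        show "zero_field_dominates ?W g' h' k'" if "\<And>y. y \<in> ?W \<Longrightarrow> 0 \<le> h' y" "\<And>y. y \<in> ?W \<Longrightarrow> 0 \<le> k' y" for g' h' k'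
          using IH[OF cardW W(2)] that by blast
        show "zero_field_dominates (insert x ?W) (g(x := \<gamma>)) (h(x := 0)) k" for \<gamma>
          unfolding W(1)
          by (rule less.hyps[OF psubset_card_mono[OF _ sub]]) (use V less.prems in auto)
      qed (use W(1) less.prems k in auto)
      then show ?thesis by (simp only: W(1))
    qed
  qed
qed


section \<open>The inequality for finite fields\<close>

definition magnetization :: "'a set \<Rightarrow> ('a \<Rightarrow> real) \<Rightarrow> 'a \<Rightarrow> real" where
  "magnetization V f x = (\<Sum>\<sigma>\<in>V \<rightarrow>\<^sub>E {-1, 1}. \<sigma> x * boltzmann E J V f \<sigma>) / Z V f"

lemma magnetization_insert:
  assumes "finite V" "x \<notin> V"
  defines "p f \<equiv> exp (f x) * Z V (\<lambda>y. f y + nbr x y)"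
    and "q f \<equiv> exp (- f x) * Z V (\<lambda>y. f y - nbr x y)"
  shows "magnetization (insert x V) f x = (p f - q f) / (p f + q f)"
  using weighted_sum_insert[OF assms(1,2), of "\<lambda>s. s" f]
  by (simp add: magnetization_def Z_insert[OF assms(1,2)] p_def q_def)

text \<open>Summing out all spins except the one at \<open>x\<close> leaves the setting of
  \<open>magnetization_gap_le\<close>; its product hypothesis is \<open>zero_field_dominates\<close>
  on \<open>V - {x}\<close>, with the couplings at \<open>x\<close> as \<open>k\<close>.\<close>

lemma magnetization_diff_le:
  assumes V: "finite V" and x: "x \<in> V" and h: "\<And>y. y \<in> V \<Longrightarrow> 0 \<le> h y"
  shows "magnetization V (\<lambda>y. g y + h y) x - magnetization V (\<lambda>y. g y - h y) x
    \<le> magnetization V h x - magnetization V (\<lambda>y. - h y) x"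
proof -
  let ?W = "V - {x}" and ?j = "nbr x"
  have W: "insert x ?W = V" "finite ?W" "x \<notin> ?W" using x V by auto
  note mag = magnetization_insert[OF W(2,3), unfolded W(1)]
  define p where "p = exp (g x + h x) * Z ?W (\<lambda>y. g y + h y + ?j y)"
  define q where "q = exp (- (g x + h x)) * Z ?W (\<lambda>y. g y + h y - ?j y)"
  define r where "r = exp (g x - h x) * Z ?W (\<lambda>y. g y - h y + ?j y)"
  define s where "s = exp (- (g x - h x)) * Z ?W (\<lambda>y. g y - h y - ?j y)"
  define P where "P = exp (h x) * Z ?W (\<lambda>y. h y + ?j y)"
  define Q where "Q = exp (- h x) * Z ?W (\<lambda>y. h y - ?j y)"
  have pos: "0 < p" "0 < q" "0 < r" "0 < s" "0 < P" "0 < Q"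
    using W by (auto simp: p_def q_def r_def s_def P_def Q_def Z_pos)
  have hW: "0 \<le> h y" if "y \<in> ?W" for y using h that by simp
  have "(p - q) / (p + q) - (r - s) / (r + s) \<le> 2 * ((P - Q) / (P + Q))"
  proof (rule magnetization_gap_le)
    show "Q \<le> P" unfolding P_def Q_def
      using Z_field_diff_le_add[OF W(2), of h ?j] hW nbr_nonneg h[OF x] Z_pos[OF W(2)]
      by (intro mult_mono) (auto intro: less_imp_le)
    have "zero_field_dominates ?W g h ?j" using W hW nbr_nonneg by (intro zero_field_dominates) auto
    then have dom: "Z ?W (\<lambda>y. g y + h y + ?j y) * Z ?W (\<lambda>y. g y - h y - ?j y) * (Z ?W (\<lambda>y. h y - ?j y))\<^sup>2
        \<le> Z ?W (\<lambda>y. g y + h y - ?j y) * Z ?W (\<lambda>y. g y - h y + ?j y) * (Z ?W (\<lambda>y. h y + ?j y))\<^sup>2"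
      by (simp add: zero_field_dominates_def algebra_simps)
    \<comment> \<open>The field at \<open>x\<close> itself cancels on both sides of the product
      inequality.\<close>
    have ex: "exp (g x + h x) * exp (- (g x - h x)) * (exp (- h x))\<^sup>2 = 1"
      "exp (- (g x + h x)) * exp (g x - h x) * (exp (h x))\<^sup>2 = 1"
      by (simp_all add: power2_eq_square flip: exp_add)
    have "p * s * Q\<^sup>2 = (exp (g x + h x) * exp (- (g x - h x)) * (exp (- h x))\<^sup>2)
        * (Z ?W (\<lambda>y. g y + h y + ?j y) * Z ?W (\<lambda>y. g y - h y - ?j y) * (Z ?W (\<lambda>y. h y - ?j y))\<^sup>2)"
      by (simp only: p_def s_def Q_def power_mult_distrib mult_ac)
    moreover have "q * r * P\<^sup>2 = (exp (- (g x + h x)) * exp (g x - h x) * (exp (h x))\<^sup>2)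
        * (Z ?W (\<lambda>y. g y + h y - ?j y) * Z ?W (\<lambda>y. g y - h y + ?j y) * (Z ?W (\<lambda>y. h y + ?j y))\<^sup>2)"
      by (simp only: q_def r_def P_def power_mult_distrib mult_ac)
    ultimately show "p * s * Q\<^sup>2 \<le> q * r * P\<^sup>2" using dom unfolding ex by simp
  qed (rule pos)+
  \<comment> \<open>By spin flip the right side of the claim is twice the magnetization under
    \<open>h\<close>, as in \<open>magnetization_gap_le\<close>.\<close>
  moreover have "magnetization V (\<lambda>y. - h y) x = - ((P - Q) / (P + Q))"
  proof -
    have "Z ?W (\<lambda>y. - h y + ?j y) = Z ?W (\<lambda>y. h y - ?j y)" "Z ?W (\<lambda>y. - h y - ?j y) = Z ?W (\<lambda>y. h y + ?j y)"
      using Z_uminus[OF W(2), of "\<lambda>y. h y - ?j y"] Z_uminus[OF W(2), of "\<lambda>y. h y + ?j y"]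
      by (simp_all add: algebra_simps)
    then have "magnetization V (\<lambda>y. - h y) x = (Q - P) / (Q + P)" by (simp add: mag P_def Q_def)
    also have "\<dots> = - ((P - Q) / (P + Q))" by (metis add.commute minus_diff_eq minus_divide_left)
    finally show ?thesis .
  qed
  ultimately show ?thesis by (simp add: mag p_def q_def r_def s_def P_def Q_def)
qed

end

section \<open>Infinite fields as limits of finite ones\<close>

definition cutoff :: "nat \<Rightarrow> ereal \<Rightarrow> real" where
  "cutoff n x = (if x = \<infinity> then real n else if x = -\<infinity> then - real n else real_of_ereal x)"

lemma cutoff_tendsto: "(\<lambda>n. ereal (cutoff n x)) \<longlonglongrightarrow> x"
proof (cases x)
  case (real r) then show ?thesis by (simp add: cutoff_def)
next
  case PInf then show ?thesis by (simp add: cutoff_def tendsto_PInfty_eq_at_top filterlim_real_sequentially)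
next
  case MInf
  have "(\<lambda>n. - ereal (real n)) \<longlonglongrightarrow> - \<infinity>"
    by (intro tendsto_uminus_ereal) (simp add: tendsto_PInfty_eq_at_top filterlim_real_sequentially)
  then show ?thesis using MInf by (simp add: cutoff_def)
qed

text \<open>Dividing out the diverging factor \<open>exp \<bar>F n\<bar>\<close> at the sites with infinite field leaves the
  constraint on the spin there.\<close>

definition site_limit :: "ereal \<Rightarrow> real \<Rightarrow> real" where
  "site_limit f s = (if f = \<infinity> then of_bool (s = 1) else if f = -\<infinity> then of_bool (s = -1) else exp (real_of_ereal f * s))"

text \<open>At an infinite field the exponent is eventually 0 if the spin agrees with the sign of
  the field, and \<open>- 2 * \<bar>F n\<bar>\<close> otherwise.\<close>

lemma site_tendsto:
  assumes F: "(\<lambda>n. ereal (F n)) \<longlonglongrightarrow> f" and s: "s = -1 \<or> s = 1"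
  shows "(\<lambda>n. exp (F n * s - (if \<bar>f\<bar> = \<infinity> then \<bar>F n\<bar> else 0))) \<longlonglongrightarrow> site_limit f s"
proof (cases f)
  case (real r)
  then have "F \<longlonglongrightarrow> r" using F by simp
  then show ?thesis using real by (auto simp: site_limit_def intro!: tendsto_intros)
next
  case PInf
  then have top: "filterlim F at_top sequentially" using F by (simp add: tendsto_PInfty_eq_at_top)
  then have ev: "eventually (\<lambda>n. 0 \<le> F n) sequentially" by (simp add: filterlim_at_top)
  have "(\<lambda>n. exp (- (2 * F n))) \<longlonglongrightarrow> 0"
    by (rule filterlim_compose[OF exp_at_bot])
      (intro filterlim_compose[OF filterlim_uminus_at_bot_at_top] filterlim_tendsto_pos_mult_at_top[OF tendsto_const _ top], simp)
  moreover have "eventually (\<lambda>n. exp (F n * s - \<bar>F n\<bar>) = (if s = 1 then 1 else exp (- (2 * F n)))) sequentially"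
    using ev s by (auto elim!: eventually_mono)
  ultimately show ?thesis using PInf s
    by (auto simp: site_limit_def tendsto_cong)
next
  case MInf
  have "(\<lambda>n. - ereal (F n)) \<longlonglongrightarrow> - f" using F by (rule tendsto_uminus_ereal)
  then have top: "filterlim (\<lambda>n. - F n) at_top sequentially" using MInf by (simp add: tendsto_PInfty_eq_at_top)
  then have ev: "eventually (\<lambda>n. 0 \<le> - F n) sequentially" unfolding filterlim_at_top by blast
  have "(\<lambda>n. exp (- (2 * - F n))) \<longlonglongrightarrow> 0"
    by (rule filterlim_compose[OF exp_at_bot])
      (intro filterlim_compose[OF filterlim_uminus_at_bot_at_top] filterlim_tendsto_pos_mult_at_top[OF tendsto_const _ top], simp)
  moreover have "eventually (\<lambda>n. exp (F n * s - \<bar>F n\<bar>) = (if s = -1 then 1 else exp (- (2 * - F n)))) sequentially"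
    using ev s by (auto elim!: eventually_mono)
  ultimately show ?thesis using MInf s
    by (auto simp: site_limit_def tendsto_cong)
qed

text \<open>The diverging factor \<open>exp (\<Sum>u\<in>V. c n u)\<close> does not depend on the
  configuration, so it cancels between numerator and denominator. What remains converges to the
  constrained weights, whose sum is positive.\<close>

lemma ising_expectation_tendsto:
  assumes V: "finite V" and E: "simple_graph V E"
    and F: "\<And>u. u \<in> V \<Longrightarrow> (\<lambda>n. ereal (F n u)) \<longlonglongrightarrow> f u"
  shows "(\<lambda>n. (\<Sum>\<sigma>\<in>V \<rightarrow>\<^sub>E {-1, 1}. X \<sigma> * boltzmann E J V (F n) \<sigma>) / (\<Sum>\<sigma>\<in>V \<rightarrow>\<^sub>E {-1, 1}. boltzmann E J V (F n) \<sigma>))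
    \<longlonglongrightarrow> ising_expectation V E J f X"
proof -
  let ?S = "V \<rightarrow>\<^sub>E {-1, 1 :: real}"
  have fin: "finite ?S" using V by (simp add: finite_PiE)
  have EV: "{e. e \<in> E \<and> e \<subseteq> V} = E" using E by (auto simp: simple_graph_def)
  define I where "I \<sigma> = (\<Sum>e\<in>E. J e * (\<Prod>u\<in>e. \<sigma> u))" for \<sigma> :: "'a \<Rightarrow> real"
  define c where "c n u = (if \<bar>f u\<bar> = \<infinity> then \<bar>F n u\<bar> else 0)" for n u
  define \<omega> where "\<omega> n \<sigma> = exp (I \<sigma>) * (\<Prod>u\<in>V. exp (F n u * \<sigma> u - c n u))" for n and \<sigma> :: "'a \<Rightarrow> real"
  define w where "w \<sigma> = (if \<sigma> \<in> spin_configs V f then ising_weight V E J f \<sigma> else 0)" for \<sigma>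
  have \<omega>: "boltzmann E J V (F n) \<sigma> = exp (\<Sum>u\<in>V. c n u) * \<omega> n \<sigma>" for n \<sigma>
    by (simp only: boltzmann_def \<omega>_def EV I_def exp_sum[OF V, symmetric] sum_subtractf exp_add[symmetric]) simp
  have lim: "(\<lambda>n. \<omega> n \<sigma>) \<longlonglongrightarrow> w \<sigma>" if \<sigma>: "\<sigma> \<in> ?S" for \<sigma>
  proof -
    have "(\<lambda>n. \<omega> n \<sigma>) \<longlonglongrightarrow> exp (I \<sigma>) * (\<Prod>u\<in>V. site_limit (f u) (\<sigma> u))"
      unfolding \<omega>_def c_def
      by (intro tendsto_mult tendsto_const tendsto_prod site_tendsto F) (use \<sigma> in auto)
    moreover have "exp (I \<sigma>) * (\<Prod>u\<in>V. site_limit (f u) (\<sigma> u)) = w \<sigma>"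
    proof (cases "\<sigma> \<in> spin_configs V f")
      case True
      then have "(\<Prod>u\<in>V. site_limit (f u) (\<sigma> u)) = (\<Prod>u\<in>V. if \<bar>f u\<bar> \<noteq> \<infinity> then exp (real_of_ereal (f u) * \<sigma> u) else 1)"
        by (intro prod.cong) (auto simp: site_limit_def spin_configs_def)
      also have "\<dots> = exp (\<Sum>u\<in>{u\<in>V. \<bar>f u\<bar> \<noteq> \<infinity>}. real_of_ereal (f u) * \<sigma> u)"
        using V by (simp add: exp_sum prod.inter_filter)
      finally show ?thesis using True by (simp add: w_def ising_weight_def I_def exp_add)
    next
      case False
      then obtain u where "u \<in> V" "site_limit (f u) (\<sigma> u) = 0"
        using \<sigma> by (auto simp: spin_configs_def site_limit_def)
      then have "(\<Prod>u\<in>V. site_limit (f u) (\<sigma> u)) = 0" using V by (meson prod_zero)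
      then show ?thesis using False by (simp add: w_def)
    qed
    ultimately show ?thesis by simp
  qed
  have boltz: "(\<Sum>\<sigma>\<in>?S. Y \<sigma> * boltzmann E J V (F n) \<sigma>) = exp (\<Sum>u\<in>V. c n u) * (\<Sum>\<sigma>\<in>?S. Y \<sigma> * \<omega> n \<sigma>)"
    for n and Y :: "('a \<Rightarrow> real) \<Rightarrow> real"
    by (simp add: \<omega> sum_distrib_left mult.left_commute)
  have sub: "spin_configs V f \<subseteq> ?S" by (auto simp: spin_configs_def)
  have sum_w: "(\<Sum>\<sigma>\<in>?S. Y \<sigma> * w \<sigma>) = (\<Sum>\<sigma>\<in>spin_configs V f. Y \<sigma> * ising_weight V E J f \<sigma>)" for Y :: "('a \<Rightarrow> real) \<Rightarrow> real"
    by (rule sum.mono_neutral_cong_right) (use fin sub in \<open>auto simp: w_def\<close>)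
  have "(\<lambda>n. (\<Sum>\<sigma>\<in>?S. X \<sigma> * \<omega> n \<sigma>) / (\<Sum>\<sigma>\<in>?S. \<omega> n \<sigma>)) \<longlonglongrightarrow> (\<Sum>\<sigma>\<in>?S. X \<sigma> * w \<sigma>) / (\<Sum>\<sigma>\<in>?S. w \<sigma>)"
  proof (intro tendsto_divide tendsto_sum tendsto_mult tendsto_const lim)
    show "(\<Sum>\<sigma>\<in>?S. w \<sigma>) \<noteq> 0"
      using sum_w[of "\<lambda>_. 1"] ising_Z_pos[OF V, of E J f] by (simp add: ising_Z_def)
  qed
  also have "(\<Sum>\<sigma>\<in>?S. X \<sigma> * w \<sigma>) / (\<Sum>\<sigma>\<in>?S. w \<sigma>) = ising_expectation V E J f X"
    using sum_w[of "\<lambda>_. 1"] sum_w[of X] by (simp add: ising_expectation_eq[OF V] ising_Z_def)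
  finally show ?thesis using boltz[of X] boltz[of "\<lambda>_. 1"] by simp
qed

section \<open>The inequality for fields with infinite values\<close>

theorem theorem1p1:
  fixes V :: "'a set" and E :: "'a set set" and J :: "'a set \<Rightarrow> real"
    and g h :: "'a \<Rightarrow> ereal" and v\<^sub>0 :: 'a
  assumes "finite V" and "simple_graph V E"
    and "\<And>e. e \<in> E \<Longrightarrow> 0 \<le> J e"
    and "\<And>v. v \<in> V \<Longrightarrow> 0 \<le> h v"
    and "\<And>v. v \<in> V \<Longrightarrow> min \<bar>g v\<bar> (h v) < \<infinity>"
    and "v\<^sub>0 \<in> V"
  shows "ising_expectation V E J (\<lambda>v. g v + h v) (\<lambda>\<sigma>. \<sigma> v\<^sub>0)
           - ising_expectation V E J (\<lambda>v. g v - h v) (\<lambda>\<sigma>. \<sigma> v\<^sub>0)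
         \<le> ising_expectation V E J h (\<lambda>\<sigma>. \<sigma> v\<^sub>0)
           - ising_expectation V E J (\<lambda>v. - h v) (\<lambda>\<sigma>. \<sigma> v\<^sub>0)"
proof -
  interpret ferromagnet E J
    using assms(2,3) by unfold_locales (fastforce simp: simple_graph_def)+
  define G where "G n u = cutoff n (g u)" for n u
  define H where "H n u = cutoff n (h u)" for n u
  have G: "(\<lambda>n. ereal (G n u)) \<longlonglongrightarrow> g u" and H: "(\<lambda>n. ereal (H n u)) \<longlonglongrightarrow> h u" for u
    by (simp_all add: G_def H_def cutoff_tendsto)
  \<comment> \<open>At no vertex are both fields infinite, so no sum of opposite infinities occurs
    and the cutoffs of \<open>g\<close> and \<open>h\<close> may be added and subtracted in the
    limit.\<close>
  have ok: "\<bar>g u\<bar> \<noteq> \<infinity> \<or> \<bar>h u\<bar> \<noteq> \<infinity>" if "u \<in> V" for u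
    using assms(4,5)[OF that] by (cases "g u"; cases "h u") auto
  have lim: "(\<lambda>n. magnetization V (F n) v\<^sub>0) \<longlonglongrightarrow> ising_expectation V E J f (\<lambda>\<sigma>. \<sigma> v\<^sub>0)"
    if "\<And>u. u \<in> V \<Longrightarrow> (\<lambda>n. ereal (F n u)) \<longlonglongrightarrow> f u" for F f
    using ising_expectation_tendsto[OF assms(1,2) that] by (simp add: magnetization_def Z_def)
  have "(\<lambda>n. magnetization V (\<lambda>u. G n u + H n u) v\<^sub>0 - magnetization V (\<lambda>u. G n u - H n u) v\<^sub>0)
      \<longlonglongrightarrow> ising_expectation V E J (\<lambda>v. g v + h v) (\<lambda>\<sigma>. \<sigma> v\<^sub>0)
           - ising_expectation V E J (\<lambda>v. g v - h v) (\<lambda>\<sigma>. \<sigma> v\<^sub>0)"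
  proof (intro tendsto_diff lim)
    fix u assume u: "u \<in> V"
    have "\<not> (g u = \<infinity> \<and> h u = -\<infinity> \<or> g u = -\<infinity> \<and> h u = \<infinity>)"
      "\<not> (g u = \<infinity> \<and> - h u = -\<infinity> \<or> g u = -\<infinity> \<and> - h u = \<infinity>)"
      using ok[OF u] by auto
    note lims = tendsto_add_ereal_general[OF this(1) G H]
      tendsto_add_ereal_general[OF this(2) G tendsto_uminus_ereal[OF H]]
    show "(\<lambda>n. ereal (G n u + H n u)) \<longlonglongrightarrow> g u + h u" using lims(1) by simp
    show "(\<lambda>n. ereal (G n u - H n u)) \<longlonglongrightarrow> g u - h u" using lims(2) by (simp add: minus_ereal_def)
  qed
  moreover have "(\<lambda>n. magnetization V (H n) v\<^sub>0 - magnetization V (\<lambda>u. - H n u) v\<^sub>0)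
      \<longlonglongrightarrow> ising_expectation V E J h (\<lambda>\<sigma>. \<sigma> v\<^sub>0) - ising_expectation V E J (\<lambda>v. - h v) (\<lambda>\<sigma>. \<sigma> v\<^sub>0)"
    using tendsto_uminus_ereal[OF H] by (intro tendsto_diff lim) (auto intro: H)
  moreover have "0 \<le> H n u" if "u \<in> V" for n u
    using assms(4)[OF that] by (auto simp: H_def cutoff_def real_of_ereal_pos)
  then have "magnetization V (\<lambda>u. G n u + H n u) v\<^sub>0 - magnetization V (\<lambda>u. G n u - H n u) v\<^sub>0
      \<le> magnetization V (H n) v\<^sub>0 - magnetization V (\<lambda>u. - H n u) v\<^sub>0" for n
    by (intro magnetization_diff_le assms)
  ultimately show ?thesis by (intro LIMSEQ_le) auto
qed

end
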